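(* Let $\alpha$ be a real number with $\alpha\in[0,\frac{1}{2}]$, and let $G$ be a connected 1-binding graph of even order $n$ with $n\geq n(\alpha)$, where $n(\alpha)=\max\{18,\frac{2+8\alpha}{1-2\alpha}\}$ if $\alpha\in[0,\frac{1}{2})$, and $n(\alpha)=18$ if $\alpha=\frac{1}{2}$. If $$\rho_{\alpha}(G)\geq\rho_{\alpha}(K_1\vee(K_{n-5}\cup K_3\cup K_1)),$$ then $G$ has a perfect matching, unless $G=K_1\vee(K_{n-5}\cup K_3\cup K_1)$.
   Context: All graphs are finite, simple and undirected. For a graph $G$ and $X\subseteq V(G)$, $N_G(X)$ denotes the set of neighbors of $X$ in $G$. The binding number of $G$ is $\mathrm{bind}(G)=\min\{|N_G(X)|/|X| : \emptyset\neq X\subseteq V(G),\ N_G(X)\neq V(G)\}$; $G$ is 1-binding if $\mathrm{bind}(G)\geq 1$. For $\alpha\in[0,1]$, the $A_\alpha$-matrix of $G$ is $A_\alpha(G)=\alpha D(G)+(1-\alpha)A(G)$, where $A(G)$ is the adjacency matrix and $D(G)$ the diagonal matrix of vertex degrees; $\rho_\alpha(G)$ denotes the largest eigenvalue of $A_\alpha(G)$. $K_m$ is the complete graph on $m$ vertices; $G_1\cup G_2$ is the disjoint union, and $G_1\vee G_2$ is the join (disjoint union plus all edges between $V(G_1)$ and $V(G_2)$). A perfect matching is a set of pairwise nonadjacent edges covering every vertex. *)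

theory Defs
  imports Main "HOL.Real"
begin

definition simple_graph :: "'a set \<Rightarrow> ('a \<Rightarrow> 'a \<Rightarrow> bool) \<Rightarrow> bool" where
  "simple_graph V E \<longleftrightarrow> finite V \<and> (\<forall>u v. E u v \<longrightarrow> u \<in> V \<and> v \<in> V)
     \<and> (\<forall>u v. E u v \<longrightarrow> E v u) \<and> (\<forall>u. \<not> E u u)"

definition connected_graph :: "'a set \<Rightarrow> ('a \<Rightarrow> 'a \<Rightarrow> bool) \<Rightarrow> bool" where
  "connected_graph V E \<longleftrightarrow> V \<noteq> {} \<and> (\<forall>u\<in>V. \<forall>v\<in>V. E\<^sup>*\<^sup>* u v)"

definition nbhd :: "'a set \<Rightarrow> ('a \<Rightarrow> 'a \<Rightarrow> bool) \<Rightarrow> 'a set \<Rightarrow> 'a set" where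
  "nbhd V E X = {v \<in> V. \<exists>x\<in>X. E x v}"

definition one_binding :: "'a set \<Rightarrow> ('a \<Rightarrow> 'a \<Rightarrow> bool) \<Rightarrow> bool" where
  "one_binding V E \<longleftrightarrow> (\<forall>X. X \<subseteq> V \<and> X \<noteq> {} \<and> nbhd V E X \<noteq> V
       \<longrightarrow> real (card (nbhd V E X)) / real (card X) \<ge> 1)"

definition degree :: "'a set \<Rightarrow> ('a \<Rightarrow> 'a \<Rightarrow> bool) \<Rightarrow> 'a \<Rightarrow> nat" where
  "degree V E v = card {w \<in> V. E v w}"

definition A_alpha :: "real \<Rightarrow> 'a set \<Rightarrow> ('a \<Rightarrow> 'a \<Rightarrow> bool) \<Rightarrow> 'a \<Rightarrow> 'a \<Rightarrow> real" where
  "A_alpha \<alpha> V E u v = (if u = v then \<alpha> * real (degree V E u) else 0)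
      + (1 - \<alpha>) * (if E u v then 1 else 0)"

text \<open>Eigenvalues of the (real symmetric) matrix A_alpha(G), indexed by V.
Since the matrix is real symmetric, all its eigenvalues are real.\<close>
definition A_alpha_eigenvalues :: "real \<Rightarrow> 'a set \<Rightarrow> ('a \<Rightarrow> 'a \<Rightarrow> bool) \<Rightarrow> real set" where
  "A_alpha_eigenvalues \<alpha> V E = {mu. \<exists>x :: 'a \<Rightarrow> real. (\<exists>v\<in>V. x v \<noteq> 0) \<and>
      (\<forall>v\<in>V. (\<Sum>u\<in>V. A_alpha \<alpha> V E v u * x u) = mu * x v)}"

definition rho_alpha :: "real \<Rightarrow> 'a set \<Rightarrow> ('a \<Rightarrow> 'a \<Rightarrow> bool) \<Rightarrow> real" where
  "rho_alpha \<alpha> V E = Max (A_alpha_eigenvalues \<alpha> V E)"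

definition perfect_matching :: "'a set \<Rightarrow> ('a \<Rightarrow> 'a \<Rightarrow> bool) \<Rightarrow> 'a set set \<Rightarrow> bool" where
  "perfect_matching V E M \<longleftrightarrow> M \<subseteq> {{u, v} | u v. u \<in> V \<and> v \<in> V \<and> E u v}
      \<and> (\<forall>v\<in>V. \<exists>!e. e \<in> M \<and> v \<in> e)"

definition has_perfect_matching :: "'a set \<Rightarrow> ('a \<Rightarrow> 'a \<Rightarrow> bool) \<Rightarrow> bool" where
  "has_perfect_matching V E \<longleftrightarrow> (\<exists>M. perfect_matching V E M)"

definition graph_iso :: "'a set \<Rightarrow> ('a \<Rightarrow> 'a \<Rightarrow> bool) \<Rightarrow> 'b set \<Rightarrow> ('b \<Rightarrow> 'b \<Rightarrow> bool) \<Rightarrow> bool" where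
  "graph_iso V E V' E' \<longleftrightarrow> (\<exists>f. bij_betw f V V' \<and>
      (\<forall>u\<in>V. \<forall>v\<in>V. E u v \<longleftrightarrow> E' (f u) (f v)))"

text \<open>The graph K_1 \<or> (K_{n-5} \<union> K_3 \<union> K_1) on vertices {0..<n}:
vertex 0 is the K_1 joined to everything; {1..n-5} is K_{n-5};
{n-4, n-3, n-2} is K_3; n-1 is the other K_1.\<close>
definition part :: "nat \<Rightarrow> nat \<Rightarrow> nat" where
  "part n v = (if v = 0 then 0 else if v \<le> n - 5 then 1 else if v \<le> n - 2 then 2 else 3)"

definition extremal_V :: "nat \<Rightarrow> nat set" where
  "extremal_V n = {0..<n}"

definition extremal_E :: "nat \<Rightarrow> nat \<Rightarrow> nat \<Rightarrow> bool" where
  "extremal_E n u v \<longleftrightarrow> u < n \<and> v < n \<and> u \<noteq> v \<and>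
      (u = 0 \<or> v = 0 \<or> part n u = part n v)"

end

theory Submission
  imports Defs "HOL-Library.Disjoint_Sets" "Jordan_Normal_Form.Spectral_Radius"
begin

text \<open>
  If \<open>G\<close> has no perfect matching, Tutte's theorem gives a set \<open>S\<close> of \<open>s\<close> vertices whose removal
  leaves at least \<open>s + 2\<close> odd components; being 1-binding allows at most \<open>s\<close> of them to be singletons,
  so every component has at most \<open>n - 2s - 3\<close> vertices. Unless \<open>s = 1\<close> and the components have sizes
  \<open>n - 5\<close>, \<open>3\<close>, \<open>1\<close>, an explicit positive vector \<open>y\<close> with \<open>A\<^sub>\<alpha> y \<le> \<lambda> y\<close> bounds the largest eigenvalue:
  by \<open>\<lambda> = n - 5\<close> for \<open>\<alpha> = 0\<close> and by \<open>\<lambda> = n - 5 + 2/(n - 4)\<close> for \<open>\<alpha> = 1/2\<close>. Since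
  \<open>A\<^sub>\<alpha> = (1 - 2\<alpha>) A\<^sub>0 + 2\<alpha> A\<^bsub>1/2\<^esub>\<close>, the largest eigenvalue of \<open>A\<^sub>\<alpha>\<close> is at most
  \<open>n - 5 + 4\<alpha>/(n - 4)\<close>, which is less than that of the extremal graph. In the remaining case \<open>G\<close> is
  a spanning subgraph of the extremal graph, and a proper subgraph has smaller spectral radius.
\<close>

text \<open>Two unknowns obstruct a direct comparison: the real parameter \<open>\<alpha>\<close>,
  and the number and sizes of the components. The threshold \<open>n - 5 + 4\<alpha>/(n - 4)\<close>
  is the Rayleigh quotient of the extremal graph at the indicator of its clique on
  \<open>n - 4\<close> vertices, hence a lower bound for its spectral radius, and it is affine in
  \<open>\<alpha>\<close> just as the matrix is. So estimates are needed only at the two end points,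
  each with a test vector of its own, and they come down to polynomial inequalities in
  \<open>n\<close> and \<open>s\<close>. A component of size \<open>c\<close> enters only through
  the convex function \<open>c / (K - c)\<close>; replacing it by a chord leaves a sum that depends
  on the number and the total size of the components alone. For \<open>s = 1\<close> and a component
  of size \<open>n - 5\<close> no such estimate can succeed, as \<open>G\<close> may be the extremal
  graph itself, so that case is compared with the extremal graph directly. Spectral radii are
  bounded throughout by an identity for symmetric matrices, which turns a positive vector with
  \<open>A y \<le> l y\<close> into a bound for the quadratic form.\<close>

section \<open>Perfect matchings and Tutte's theorem\<close>

text \<open>A matching is coded as the involution that swaps partners: pairings of disjoint sets
  glue by cases, and an alternating walk along two matchings is an iteration of the composite of two
  involutions.\<close>

definition pairing :: "('a \<Rightarrow> 'a \<Rightarrow> bool) \<Rightarrow> 'a set \<Rightarrow> ('a \<Rightarrow> 'a) \<Rightarrow> bool" where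
  "pairing E W m \<longleftrightarrow> (\<forall>v\<in>W. m v \<in> W \<and> m (m v) = v \<and> E v (m v))"

lemma has_perfect_matching_pairing:
  assumes "pairing E V m"
  shows "has_perfect_matching V E"
proof -
  have m: "m v \<in> V" "m (m v) = v" "E v (m v)" if "v \<in> V" for v
    using assms that by (auto simp: pairing_def)
  let ?M = "(\<lambda>v. {v, m v}) ` V"
  have "?M \<subseteq> {{u, v} | u v. u \<in> V \<and> v \<in> V \<and> E u v}"
    using m by blast
  moreover have "\<exists>!e. e \<in> ?M \<and> v \<in> e" if "v \<in> V" for v
  proof (rule ex1I[of _ "{v, m v}"])
    show "{v, m v} \<in> ?M \<and> v \<in> {v, m v}" using that by simp
    fix e assume "e \<in> ?M \<and> v \<in> e"
    then obtain u where "u \<in> V" "e = {u, m u}" "v = u \<or> v = m u" by blast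
    then show "e = {v, m v}" using m(2)[of u] by auto
  qed
  ultimately have "perfect_matching V E ?M" unfolding perfect_matching_def by simp
  then show ?thesis unfolding has_perfect_matching_def ..
qed

lemma pairing_Un:
  assumes "pairing E A f" "pairing E B g" "A \<inter> B = {}"
  shows "pairing E (A \<union> B) (\<lambda>v. if v \<in> A then f v else g v)"
  unfolding pairing_def
proof (intro ballI)
  fix v assume "v \<in> A \<union> B"
  then consider "v \<in> A" | "v \<in> B" "v \<notin> A" by blast
  then show "(if v \<in> A then f v else g v) \<in> A \<union> B \<and>
    (if (if v \<in> A then f v else g v) \<in> A then f (if v \<in> A then f v else g v)
      else g (if v \<in> A then f v else g v)) = v \<and> E v (if v \<in> A then f v else g v)"
  proof cases
    case 1
    then show ?thesis using assms(1) by (simp add: pairing_def)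
  next
    case 2
    then have "g v \<in> B" "g (g v) = v" "E v (g v)" using assms(2) by (auto simp: pairing_def)
    moreover have "g v \<notin> A" using assms(3) \<open>g v \<in> B\<close> by blast
    ultimately show ?thesis using 2 by simp
  qed
qed

lemma ex_pairing_Union:
  assumes "finite F" "\<And>X. X \<in> F \<Longrightarrow> \<exists>m. pairing E X m" "disjoint F"
  shows "\<exists>m. pairing E (\<Union>F) m"
  using assms
proof (induction F rule: finite_induct)
  case empty
  then show ?case by (auto simp: pairing_def)
next
  case (insert X F)
  have "X \<inter> \<Union>F = {}"
    using insert.hyps(2) insert.prems(2) by (fastforce simp: disjoint_def)
  moreover have "disjoint F" using insert.prems(2) by (auto simp: disjoint_def)
  then have "\<exists>m. pairing E (\<Union>F) m" using insert.IH insert.prems(1) by blast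
  moreover obtain f where "pairing E X f" using insert.prems(1) by blast
  ultimately have "\<exists>m. pairing E (X \<union> \<Union>F) m" using pairing_Un by blast
  then show ?case by simp
qed

lemma ex_pairing_even_clique:
  assumes "finite W" "even (card W)" "\<And>u v. u \<in> W \<Longrightarrow> v \<in> W \<Longrightarrow> u \<noteq> v \<Longrightarrow> E u v"
  shows "\<exists>m. pairing E W m"
  using assms
proof (induction W rule: finite_psubset_induct)
  case (psubset W)
  show ?case
  proof (cases "W = {}")
    case True
    then show ?thesis by (auto simp: pairing_def)
  next
    case False
    then obtain u where u: "u \<in> W" by blast
    have "W \<noteq> {u}" using psubset.prems(1) by auto
    then obtain v where v: "v \<in> W" "v \<noteq> u" using u by blast
    let ?W = "W - {u, v}"
    have "card W = card ?W + 2"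
      using u v psubset.hyps card_Diff_subset[of "{u,v}" W] card_mono[of W "{u,v}"] by simp
    then have "even (card ?W)" using psubset.prems(1) by simp
    then obtain f where f: "pairing E ?W f"
      using psubset.IH[of ?W] u v psubset.prems(2) by blast
    have "pairing E {u, v} (\<lambda>w. if w = u then v else u)"
      using u v psubset.prems(2) by (auto simp: pairing_def)
    from pairing_Un[OF this f] have "\<exists>m. pairing E ({u, v} \<union> ?W) m" by blast
    moreover have "{u, v} \<union> ?W = W" using u v by blast
    ultimately show ?thesis by simp
  qed
qed

section \<open>Exchanging two matchings along an alternating walk\<close>

definition add_edge :: "('a \<Rightarrow> 'a \<Rightarrow> bool) \<Rightarrow> 'a \<Rightarrow> 'a \<Rightarrow> 'a \<Rightarrow> 'a \<Rightarrow> bool" where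
  "add_edge E a c u v \<longleftrightarrow> E u v \<or> (u = a \<and> v = c) \<or> (u = c \<and> v = a)"

lemma simple_graph_add_edge:
  "simple_graph V E \<Longrightarrow> a \<in> V \<Longrightarrow> c \<in> V \<Longrightarrow> a \<noteq> c \<Longrightarrow> simple_graph V (add_edge E a c)"
  by (auto simp: simple_graph_def add_edge_def)

text \<open>Two perfect matchings together form even cycles, so an even number of steps from
  \<open>x\<close> cannot end at its partner \<open>f x\<close>. Stripping one step from each end of
  such an equation gives the same equation for \<open>(h \<circ> f) x\<close> with
  \<open>i - 2\<close>; the descent ends in a fixed point of \<open>f\<close> or of
  \<open>h\<close>.\<close>

lemma mirror_not_in_orbit:
  assumes f: "\<And>v. v \<in> V \<Longrightarrow> f v \<in> V \<and> f (f v) = v \<and> f v \<noteq> v"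
    and h: "\<And>v. v \<in> V \<Longrightarrow> h v \<in> V \<and> h (h v) = v \<and> h v \<noteq> v"
    and "x \<in> V"
  shows "f x \<noteq> ((h \<circ> f) ^^ i) x"
  using \<open>x \<in> V\<close>
proof (induction i arbitrary: x rule: less_induct)
  case (less i)
  consider "i = 0" | "i = 1" | j where "i = Suc (Suc j)"
    by (metis One_nat_def not0_implies_Suc)
  then show ?case
  proof cases
    case 1
    then show ?thesis using f less.prems by simp
  next
    case 2
    then show ?thesis using f[OF less.prems] h[of "f x"] by auto
  next
    case 3
    let ?g = "h \<circ> f"
    show ?thesis
    proof
      assume "f x = (?g ^^ i) x"
      also have "\<dots> = h (f ((?g ^^ Suc j) x))" using 3 by simp
      finally have eq: "f x = h (f ((?g ^^ Suc j) x))" .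
      have "(?g ^^ k) x \<in> V" for k
        using less.prems f h by (induction k) auto
      then have "f (h (f x)) = (?g ^^ Suc j) x"
        using eq f h by metis
      also have "\<dots> = (?g ^^ j) (?g x)" by (simp only: funpow_Suc_right o_apply)
      finally have "f (?g x) = (?g ^^ j) (?g x)" by simp
      moreover have "?g x \<in> V" using less.prems f h by simp
      ultimately show False using less.IH[of j "?g x"] 3 by (metis less_add_Suc2 lessI less_SucI)
    qed
  qed
qed

text \<open>By pigeonhole two iterates agree; injectivity cancels the steps that they share, so the
  orbit has no tail before its cycle.\<close>

lemma orbit_returns:
  assumes "finite V" "inj_on g V" "\<And>v. v \<in> V \<Longrightarrow> g v \<in> V" "x \<in> V"
  shows "\<exists>p. (g ^^ Suc p) x = x"
proof -
  have V: "(g ^^ k) x \<in> V" for k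
    using assms(3,4) by (induction k) auto
  have "\<not> inj (\<lambda>k. (g ^^ k) x)"
    using V assms(1) by (meson finite_subset image_subsetI infinite_UNIV_nat finite_imageD)
  then obtain i j where "i < j" "(g ^^ i) x = (g ^^ j) x"
    unfolding inj_def by (metis linorder_neqE_nat)
  then show ?thesis
  proof (induction i arbitrary: j)
    case 0
    then show ?case by (metis funpow_0 gr0_implies_Suc)
  next
    case (Suc i)
    then obtain j' where j': "j = Suc j'" by (meson Suc_lessE)
    have "g ((g ^^ i) x) = g ((g ^^ j') x)" using Suc.prems j' by simp
    then have "(g ^^ i) x = (g ^^ j') x" using assms(2) V by (meson inj_onD)
    then show ?case using Suc.IH[of j'] Suc.prems j' by simp
  qed
qed

text \<open>Lovasz' exchange step: in the symmetric difference of the two matchings, walk from \<open>d\<close>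
  until \<open>a\<close> or \<open>c\<close> is met (then close the path up at \<open>b\<close>) or the walk returns to \<open>d\<close>.\<close>

lemma pairing_exchange:
  assumes G: "simple_graph V E" and ab: "E a b" and bc: "E b c"
    and "a \<noteq> c" "b \<noteq> d"
    and f: "pairing (add_edge E a c) V f" and h: "pairing (add_edge E b d) V h"
    and V: "a \<in> V" "b \<in> V" "c \<in> V" "d \<in> V"
  shows "\<exists>m. pairing E V m"
proof -
  have sym: "E u v \<Longrightarrow> E v u" and irr: "\<not> E u u" and fin: "finite V" for u v
    using G by (auto simp: simple_graph_def)
  show ?thesis
  proof (cases "f a = c \<and> h b = d")
    case False
    have "pairing E V f" if "f a \<noteq> c"
      using f that V unfolding pairing_def add_edge_def by metis
    moreover have "pairing E V h" if "h b \<noteq> d"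
      using h that V unfolding pairing_def add_edge_def by metis
    ultimately show ?thesis using False by blast
  next
    case True
    have f': "f v \<in> V" "f (f v) = v" "f v \<noteq> v" "add_edge E a c v (f v)" if "v \<in> V" for v
      using f that irr \<open>a \<noteq> c\<close> unfolding pairing_def add_edge_def by metis+
    have h': "h v \<in> V" "h (h v) = v" "h v \<noteq> v" "add_edge E b d v (h v)" if "v \<in> V" for v
      using h that irr \<open>b \<noteq> d\<close> unfolding pairing_def add_edge_def by metis+
    have fac: "f a = c" "f c = a" "h b = d" "h d = b" using True f'(2) h'(2) V by auto
    have fE: "E v (f v)" if "v \<in> V" "v \<noteq> a" "v \<noteq> c" for v
      using f'(4)[OF that(1)] that by (auto simp: add_edge_def)
    have hE: "E v (h v)" if "v \<in> V" "v \<noteq> b" "v \<noteq> d" for v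
      using h'(4)[OF that(1)] that by (auto simp: add_edge_def)
    \<comment> \<open>The walk leaves \<open>d\<close> along an \<open>f\<close>-edge and visits
      \<open>w i\<close> and \<open>f (w i)\<close> in turn. A meeting with \<open>a\<close> or
      \<open>c\<close> shows already on the \<open>w i\<close>, because \<open>f\<close> swaps
      \<open>a\<close> and \<open>c\<close>.\<close>
    define w where "w i = ((h \<circ> f) ^^ i) d" for i
    have w0: "w 0 = d" and wS: "w (Suc i) = h (f (w i))" for i by (simp_all add: w_def)
    have wV: "w i \<in> V" for i
      using V f' h' by (induction i) (auto simp: w0 wS)
    have hwS: "h (w (Suc i)) = f (w i)" for i using wS wV f' h' by simp
    show ?thesis
    proof (cases "\<exists>k. w k \<in> {a, c}")
      case False
      \<comment> \<open>\<open>C\<close> is the whole alternating cycle; it closes through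
        \<open>b\<close> and the \<open>h\<close>-edge from \<open>b\<close> to \<open>d\<close>. It
        contains that edge but neither \<open>a\<close> nor \<open>c\<close>, so \<open>f\<close> on
        \<open>C\<close> and \<open>h\<close> elsewhere avoids both added edges.\<close>
      define C where "C = range w \<union> range (\<lambda>i. f (w i))"
      have "inj_on (h \<circ> f) V"
        using f'(1,2) h'(2) by (intro inj_onI) (metis comp_apply)
      then obtain p where p: "w (Suc p) = d"
        using orbit_returns[OF fin, of "h \<circ> f" d] f' h' V unfolding w_def by auto
      then have b: "b = f (w p)" using hwS[of p] fac by simp
      have Cf: "f v \<in> C" if "v \<in> C" for v
        using that f'(2) wV unfolding C_def by auto
      have "h (w i) \<in> C" for i
        using hwS fac b by (cases i) (auto simp: w0 C_def)
      moreover have "h (f (w i)) \<in> C" for i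
        using wS[of i] unfolding C_def by (metis UnI1 rangeI)
      ultimately have Ch: "h v \<in> C" if "v \<in> C" for v
        using that unfolding C_def by auto
      have bd: "b \<in> C" "d \<in> C" using b w0 unfolding C_def by (auto intro: range_eqI)
      have "a \<notin> C" "c \<notin> C"
        using False fac f'(2) wV unfolding C_def by auto
      have "C \<subseteq> V" using wV f' by (auto simp: C_def)
      have "pairing E V (\<lambda>v. if v \<in> C then f v else h v)"
        unfolding pairing_def
      proof (intro ballI)
        fix v assume v: "v \<in> V"
        show "(if v \<in> C then f v else h v) \<in> V \<and>
          (if (if v \<in> C then f v else h v) \<in> C then f (if v \<in> C then f v else h v)
             else h (if v \<in> C then f v else h v)) = v \<and> E v (if v \<in> C then f v else h v)"
        proof (cases "v \<in> C")
          case True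
          then have "v \<noteq> a" "v \<noteq> c" using \<open>a \<notin> C\<close> \<open>c \<notin> C\<close> by auto
          then show ?thesis using True Cf f' fE v by simp
        next
          case False
          then have "h v \<notin> C" using Ch h'(2) v by metis
          moreover have "v \<noteq> b" "v \<noteq> d" using bd False by auto
          ultimately show ?thesis using False h' hE v by simp
        qed
      qed
      then show ?thesis by blast
    next
      case True
      define k where "k = (LEAST k. w k \<in> {a, c})"
      define p where "p = w k"
      have p: "p \<in> {a, c}" using True unfolding p_def k_def by (rule LeastI_ex)
      have min: "w i \<notin> {a, c}" if "i < k" for i using that not_less_Least unfolding k_def by blast
      \<comment> \<open>\<open>Q\<close> is the path strictly before \<open>p\<close>. It is a union
        of \<open>f\<close>-edges, while \<open>Q\<close> together with \<open>p\<close> and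
        \<open>b\<close> is a union of \<open>h\<close>-edges. Hence \<open>f\<close> on
        \<open>Q\<close>, the edge of \<open>E\<close> between \<open>p\<close> and
        \<open>b\<close>, and \<open>h\<close> on the rest fit together.\<close>
      define Q where "Q = w ` {..<k} \<union> (\<lambda>i. f (w i)) ` {..<k}"
      have QV: "Q \<subseteq> V" using wV f' by (auto simp: Q_def)
      have Qf: "f v \<in> Q" if "v \<in> Q" for v
        using that f'(2) wV unfolding Q_def by auto
      have "f (w i) \<notin> {a, c}" if "i < k" for i
        using min[OF that] f'(2)[OF wV[of i]] fac by auto
      with min have acQ: "a \<notin> Q" "c \<notin> Q" unfolding Q_def by auto
      then have pQ: "p \<notin> Q" using p by auto
      have "b \<noteq> p" "E b p" "E p b" using p ab bc irr sym by auto
      have pV: "p \<in> V" using p V by auto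
      \<comment> \<open>If \<open>b = w (Suc j)\<close>, undoing the \<open>h\<close>-step gives
        \<open>d = f (w j)\<close>, that is \<open>f d = w j\<close>, which
        \<open>mirror_not_in_orbit\<close> forbids.\<close>
      have bw: "b \<noteq> w i" for i
      proof (cases i)
        case 0
        then show ?thesis using w0 \<open>b \<noteq> d\<close> by simp
      next
        case (Suc j)
        have "f d \<noteq> w j" unfolding w_def
          by (rule mirror_not_in_orbit[of V]) (use f' h' V in auto)
        then have "d \<noteq> f (w j)" using f'(2) wV by metis
        then show ?thesis using hwS[of j] Suc fac by auto
      qed
      \<comment> \<open>Otherwise the walk is back at \<open>d\<close> after \<open>Suc i\<close>
        rounds, and \<open>p\<close> has occurred that many rounds before \<open>k\<close>.\<close>
      have "b \<noteq> f (w i)" if "i < k" for i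
      proof
        assume "b = f (w i)"
        then have "w (Suc i) = d" using wS fac by simp
        moreover have "w (j + Suc i) = ((h \<circ> f) ^^ j) (w (Suc i))" for j
          by (simp only: w_def funpow_add o_apply)
        ultimately have "w (j + Suc i) = w j" for j by (simp add: w_def)
        from this[of "k - Suc i"] have "w (k - Suc i) = p" using that by (simp add: p_def)
        then show False using min[of "k - Suc i"] p that by auto
      qed
      with bw have bQ: "b \<notin> Q" unfolding Q_def by auto
      define R where "R = Q \<union> {p, b}"
      have wR: "w i \<in> R" if "i \<le> k" for i
        using that by (cases "i = k") (auto simp: R_def Q_def p_def)
      have fwR: "f (w i) \<in> R" if "i < k" for i using that by (auto simp: R_def Q_def)
      have bR: "b \<in> R" and dR: "d \<in> R" using wR[of 0] w0 by (auto simp: R_def)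
      have "h (w i) \<in> R" if "i \<le> k" for i
        using hwS fwR that fac bR by (cases i) (auto simp: w0)
      moreover have "h (f (w i)) \<in> R" if "i < k" for i
        using wR[of "Suc i"] wS[of i] that by simp
      moreover have "v = b \<or> (\<exists>i\<le>k. v = w i) \<or> (\<exists>i<k. v = f (w i))" if "v \<in> R" for v
        using that unfolding R_def Q_def p_def by (auto intro: less_imp_le)
      ultimately have Rh: "h v \<in> R" if "v \<in> R" for v
        using that fac(3) dR by metis
      define m where "m v = (if v \<in> Q then f v else if v = p then b else if v = b then p else h v)" for v
      have "pairing E V m"
        unfolding pairing_def
      proof (intro ballI)
        fix v assume v: "v \<in> V"
        consider "v \<in> Q" | "v = p" | "v = b" | "v \<notin> R" unfolding R_def by blast
        then show "m v \<in> V \<and> m (m v) = v \<and> E v (m v)"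
        proof cases
          case 1
          then have "v \<noteq> a" "v \<noteq> c" using acQ by auto
          then show ?thesis using 1 Qf[OF 1] f' fE v by (simp add: m_def)
        next
          case 2
          then show ?thesis using pQ bQ \<open>b \<noteq> p\<close> \<open>E p b\<close> V by (simp add: m_def)
        next
          case 3
          then show ?thesis using pQ bQ \<open>b \<noteq> p\<close> \<open>E b p\<close> pV by (simp add: m_def)
        next
          case 4
          then have "h v \<notin> R" using Rh h'(2) v by metis
          moreover have "v \<noteq> b" "v \<noteq> d" using 4 bR dR by auto
          ultimately show ?thesis using 4 h' hE v by (simp add: m_def R_def)
        qed
      qed
      then show ?thesis by blast
    qed
  qed
qed

text \<open>In an edge-maximal graph without perfect matching, \<open>S\<close> is the set of
  vertices adjacent to all others, and being adjacent is transitive outside \<open>S\<close>.\<close>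

theorem tutte:
  assumes G: "simple_graph V E" and ev: "even (card V)" and no: "\<nexists>m. pairing E V m"
  obtains S \<C> where "S \<subseteq> V" "partition_on (V - S) \<C>"
    "\<And>u v. E u v \<Longrightarrow> u \<in> S \<or> v \<in> S \<or> (\<exists>C\<in>\<C>. u \<in> C \<and> v \<in> C)"
    "card S + 2 \<le> card {C\<in>\<C>. odd (card C)}"
proof -
  have fin: "finite V" using G by (simp add: simple_graph_def)
  \<comment> \<open>Supergraphs on \<open>V\<close> without perfect matching are finitely many, so a
    maximal one exists; a partition that its edges respect is also respected by the edges of
    \<open>E\<close>.\<close>
  define P where "P R \<longleftrightarrow> simple_graph V (\<lambda>u v. (u, v) \<in> R) \<and> (\<forall>u v. E u v \<longrightarrow> (u, v) \<in> R)
    \<and> (\<nexists>m. pairing (\<lambda>u v. (u, v) \<in> R) V m)" for R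
  have P0: "P {(u, v). E u v}" using G no by (simp add: P_def)
  have "Collect P \<subseteq> Pow (V \<times> V)" by (auto simp: P_def simple_graph_def)
  then have "finite (Collect P)" using fin by (meson finite_Pow_iff finite_SigmaI finite_subset)
  then obtain R where R: "P R" and maxR: "\<And>R'. P R' \<Longrightarrow> R \<subseteq> R' \<Longrightarrow> R' = R"
    using finite_has_maximal[of "Collect P"] P0 by blast
  define H where "H u v \<longleftrightarrow> (u, v) \<in> R" for u v
  have H: "simple_graph V H" "\<And>u v. E u v \<Longrightarrow> H u v" "\<nexists>m. pairing H V m"
    using R unfolding P_def H_def by auto
  have sym: "H u v \<Longrightarrow> H v u" and irr: "\<not> H u u" and HV: "H u v \<Longrightarrow> u \<in> V \<and> v \<in> V" for u v
    using H(1) by (auto simp: simple_graph_def)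
  have maxH: "\<exists>m. pairing (add_edge H a c) V m" if "a \<in> V" "c \<in> V" "a \<noteq> c" "\<not> H a c" for a c
  proof (rule ccontr)
    assume *: "\<nexists>m. pairing (add_edge H a c) V m"
    have eq: "(\<lambda>u v. (u, v) \<in> {(u, v). add_edge H a c u v}) = add_edge H a c" by simp
    have "P {(u, v). add_edge H a c u v}"
      unfolding P_def eq using * simple_graph_add_edge[OF H(1) that(1-3)] H(2)
      by (auto simp: add_edge_def)
    moreover have "R \<subseteq> {(u, v). add_edge H a c u v}" by (auto simp: add_edge_def H_def)
    ultimately have "{(u, v). add_edge H a c u v} = R" by (rule maxR)
    moreover have "(a, c) \<in> {(u, v). add_edge H a c u v}" by (simp add: add_edge_def)
    ultimately show False using that(4) by (simp add: H_def)
  qed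
  define S where "S = {v\<in>V. \<forall>u\<in>V. u \<noteq> v \<longrightarrow> H v u}"
  have SV: "S \<subseteq> V" by (auto simp: S_def)
  \<comment> \<open>A failure leaves \<open>a\<close> and \<open>c\<close> nonadjacent, and
    \<open>b \<notin> S\<close> supplies a non-neighbour \<open>d\<close> of \<open>b\<close>. By
    maximality adding either missing edge creates a matching, and these are the two matchings to be
    exchanged.\<close>
  have trans: "H a c" if "H a b" "H b c" "a \<noteq> c" "b \<notin> S" for a b c
  proof (rule ccontr)
    assume "\<not> H a c"
    have V: "a \<in> V" "b \<in> V" "c \<in> V" using HV that by auto
    obtain d where d: "d \<in> V" "b \<noteq> d" "\<not> H b d" using \<open>b \<notin> S\<close> V by (auto simp: S_def)
    from maxH[OF V(1,3) that(3) \<open>\<not> H a c\<close>] maxH[OF V(2) d] obtain f h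
      where "pairing (add_edge H a c) V f" "pairing (add_edge H b d) V h" by blast
    then show False using pairing_exchange[OF H(1) that(1-3) d(2)] V d(1) H(3) by blast
  qed
  define Q where "Q = {(u, v). u \<in> V - S \<and> v \<in> V - S \<and> (u = v \<or> H u v)}"
  have eqv: "equiv (V - S) Q"
    unfolding equiv_def refl_on_def sym_def trans_def Q_def using sym trans by blast
  define \<C> where "\<C> = (V - S) // Q"
  have part: "partition_on (V - S) \<C>"
    unfolding \<C>_def using eqv by (rule partition_on_quotient)
  have cls: "(\<exists>C\<in>\<C>. u \<in> C \<and> v \<in> C) \<longleftrightarrow> (u, v) \<in> Q" for u v
  proof
    assume "\<exists>C\<in>\<C>. u \<in> C \<and> v \<in> C"
    then show "(u, v) \<in> Q" using eqv unfolding \<C>_def by (metis quotient_eq_iff)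
  next
    assume uv: "(u, v) \<in> Q"
    then have "u \<in> V - S" by (simp add: Q_def)
    then have "Q `` {u} \<in> \<C>" "u \<in> Q `` {u}"
      unfolding \<C>_def by (auto intro: quotientI) (auto simp: Q_def)
    then show "\<exists>C\<in>\<C>. u \<in> C \<and> v \<in> C" using uv by blast
  qed
  have UC: "\<Union>\<C> = V - S" and dC: "disjoint \<C>"
    using part by (auto simp: partition_on_def)
  have finC: "finite \<C>" using part fin by (meson finite_Diff finite_elements)
  have finC': "finite C" if "C \<in> \<C>" for C
    using that UC fin by (metis Sup_upper finite_Diff finite_subset)
  define \<O> where "\<O> = {C\<in>\<C>. odd (card C)}"
  have "card (V - S) = (\<Sum>C\<in>\<C>. card C)"
    using UC dC finC' by (metis card_Union_disjoint)
  moreover have "even (\<Sum>C\<in>\<C>. card C) \<longleftrightarrow> even (card \<O>)"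
    unfolding \<O>_def using finC by (rule even_sum_iff)
  moreover have cV: "card V = card (V - S) + card S"
    using SV fin by (metis card_Diff_subset card_mono finite_subset le_add_diff_inverse2)
  ultimately have parity: "even (card S + card \<O>)" using ev by simp
  \<comment> \<open>With so few odd classes, each could borrow a vertex of \<open>S\<close> of its
    own and become an even clique. The rest of \<open>S\<close> is a clique, even by
    \<open>parity\<close>, and the pieces would match all of \<open>H\<close>.\<close>
  have "\<not> card \<O> \<le> card S"
  proof
    assume le: "card \<O> \<le> card S"
    have finO: "finite \<O>" using finC by (simp add: \<O>_def)
    obtain h where h: "h ` \<O> \<subseteq> S" "inj_on h \<O>"
      using card_le_inj[OF finO _ le] SV fin by (meson finite_subset)
    define F where "F C = (if C \<in> \<O> then insert (h C) C else C)" for C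
    have CS: "C \<inter> S = {}" if "C \<in> \<C>" for C using that UC by blast
    have hS: "h C \<in> S" if "C \<in> \<O>" for C using that h by blast
    have univ: "H u v" if "u \<in> S" "v \<in> V" "u \<noteq> v" for u v using that by (auto simp: S_def)
    have clq: "H u v" if "C \<in> \<C>" "u \<in> C" "v \<in> C" "u \<noteq> v" for C u v
      using cls[of u v] that by (auto simp: Q_def)
    have pF: "\<exists>m. pairing H (F C) m" if C: "C \<in> \<C>" for C
    proof (rule ex_pairing_even_clique)
      show "finite (F C)" using finC'[OF C] by (simp add: F_def)
      show "even (card (F C))"
        using finC'[OF C] C CS[OF C] hS[of C] by (auto simp: F_def \<O>_def card_insert_if)
      fix u v assume uv: "u \<in> F C" "v \<in> F C" "u \<noteq> v"
      have "C \<subseteq> V" using C UC by blast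
      show "H u v"
      proof (cases "C \<in> \<O>")
        case True
        then have "h C \<in> V" using hS SV by blast
        then show ?thesis using uv True hS[OF True] univ sym clq[OF C] \<open>C \<subseteq> V\<close>
          unfolding F_def by (metis insertE subsetD)
      next
        case False
        then show ?thesis using uv clq[OF C] by (simp add: F_def)
      qed
    qed
    have pS: "\<exists>m. pairing H (S - h ` \<O>) m"
    proof (rule ex_pairing_even_clique)
      show "finite (S - h ` \<O>)" using SV fin by (meson finite_Diff finite_subset)
      have "card (S - h ` \<O>) = card S - card \<O>"
        using h finO by (simp add: card_Diff_subset card_image)
      then show "even (card (S - h ` \<O>))" using parity le by simp
    qed (use univ SV in blast)
    have disj: "F C \<inter> F D = {}" if "C \<in> \<C>" "D \<in> \<C>" "C \<noteq> D" for C D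
    proof -
      have "C \<inter> D = {}" using dC that by (auto simp: disjoint_def)
      moreover have "h C \<noteq> h D" if "C \<in> \<O>" "D \<in> \<O>"
        using h(2) that \<open>C \<noteq> D\<close> by (meson inj_onD)
      ultimately show ?thesis
        using CS[OF that(1)] CS[OF that(2)] hS[of C] hS[of D] unfolding F_def by auto
    qed
    have "disjoint (F ` \<C>)" using disj unfolding disjoint_def by blast
    with pF finC have "\<exists>m. pairing H (\<Union>(F ` \<C>)) m"
      by (intro ex_pairing_Union) auto
    moreover have "\<Union>(F ` \<C>) \<inter> (S - h ` \<O>) = {}" using CS by (auto simp: F_def)
    ultimately have "\<exists>m. pairing H (\<Union>(F ` \<C>) \<union> (S - h ` \<O>)) m"
      using pS pairing_Un by blast
    moreover have "\<Union>(F ` \<C>) \<union> (S - h ` \<O>) = V"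
    proof -
      have "\<Union>(F ` \<C>) = (V - S) \<union> h ` \<O>"
        unfolding UC[symmetric] F_def by (auto simp: \<O>_def split: if_splits)
      then show ?thesis using SV h(1) by blast
    qed
    ultimately show False using H(3) by simp
  qed
  then have "card S + 2 \<le> card \<O>" using parity
    by (metis Suc_leI add_2_eq_Suc' even_Suc le_neq_implies_less not_le odd_add add_Suc_right even_add)
  moreover have "u \<in> S \<or> v \<in> S \<or> (\<exists>C\<in>\<C>. u \<in> C \<and> v \<in> C)" if "E u v" for u v
    using H(2)[OF that] HV[of u v] cls by (auto simp: Q_def)
  ultimately show ?thesis using that SV part unfolding \<O>_def by blast
qed

section \<open>Eigenvalues of symmetric matrices\<close>

text \<open>The bridge from matrices indexed by \<open>V\<close> to library matrices. The field is
  arbitrary because finiteness of the spectrum is wanted over the reals and existence of an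
  eigenvalue over the complex numbers.\<close>

lemma eigenvalue_mat_iff:
  fixes a :: "'a \<Rightarrow> 'a \<Rightarrow> 'k :: field"
  assumes f: "bij_betw f {0..<n} V"
  shows "eigenvalue (mat n n (\<lambda>(i, j). a (f i) (f j))) \<mu> \<longleftrightarrow>
    (\<exists>x. (\<exists>v\<in>V. x v \<noteq> 0) \<and> (\<forall>v\<in>V. (\<Sum>u\<in>V. a v u * x u) = \<mu> * x v))" (is "eigenvalue ?A \<mu> \<longleftrightarrow> ?R")
proof -
  have V: "V = f ` {0..<n}" and inj: "inj_on f {0..<n}" using f by (auto simp: bij_betw_def)
  have sumV: "(\<Sum>u\<in>V. g u) = (\<Sum>j=0..<n. g (f j))" for g :: "'a \<Rightarrow> 'k"
    unfolding V using inj by (simp add: sum.reindex)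
  have idx: "(?A *\<^sub>v w) $ i = (\<Sum>j=0..<n. a (f i) (f j) * w $ j)"
    if "i < n" "w \<in> carrier_vec n" for i w
    using that by (auto simp: scalar_prod_def intro!: sum.cong)
  show ?thesis
  proof
    assume "eigenvalue ?A \<mu>"
    then obtain w where w: "w \<in> carrier_vec n" "w \<noteq> 0\<^sub>v n" "?A *\<^sub>v w = \<mu> \<cdot>\<^sub>v w"
      by (auto simp: eigenvalue_def eigenvector_def)
    define x where "x v = w $ (inv_into {0..<n} f v)" for v
    have x: "x (f i) = w $ i" if "i < n" for i
      using inv_into_f_f[OF inj, of i] that by (simp add: x_def)
    obtain i where "i < n" "w $ i \<noteq> 0"
      using w(1,2) by (metis carrier_vecD eq_vecI index_zero_vec(1) index_zero_vec(2))
    then have "\<exists>v\<in>V. x v \<noteq> 0" using x by (auto simp: V)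
    moreover have "(\<Sum>u\<in>V. a v u * x u) = \<mu> * x v" if "v \<in> V" for v
    proof -
      obtain i where i: "i < n" "v = f i" using \<open>v \<in> V\<close> V by auto
      have "(\<Sum>u\<in>V. a v u * x u) = (\<Sum>j=0..<n. a (f i) (f j) * w $ j)"
        unfolding sumV by (simp add: x i)
      also have "\<dots> = (\<mu> \<cdot>\<^sub>v w) $ i" using idx[OF i(1) w(1)] w(3) by simp
      also have "\<dots> = \<mu> * x v" using w(1) i x by simp
      finally show ?thesis .
    qed
    ultimately show ?R by blast
  next
    assume ?R
    then obtain x where x: "\<exists>v\<in>V. x v \<noteq> 0" "\<And>v. v \<in> V \<Longrightarrow> (\<Sum>u\<in>V. a v u * x u) = \<mu> * x v"
      by blast
    define w where "w = vec n (\<lambda>i. x (f i))"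
    have w: "w \<in> carrier_vec n" by (simp add: w_def)
    moreover have "w \<noteq> 0\<^sub>v n"
    proof
      assume "w = 0\<^sub>v n"
      then have "x (f i) = 0" if "i < n" for i
        using that by (metis index_vec index_zero_vec(1) w_def)
      then show False using x(1) by (auto simp: V)
    qed
    moreover have "?A *\<^sub>v w = \<mu> \<cdot>\<^sub>v w"
    proof (rule eq_vecI)
      fix i assume "i < dim_vec (\<mu> \<cdot>\<^sub>v w)"
      then have i: "i < n" by (simp add: w_def)
      then have "(?A *\<^sub>v w) $ i = (\<Sum>u\<in>V. a (f i) u * x u)"
        using idx[OF i w] by (simp add: sumV w_def)
      then show "(?A *\<^sub>v w) $ i = (\<mu> \<cdot>\<^sub>v w) $ i"
        using x(2)[of "f i"] i by (simp add: V w_def)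
    qed (simp add: w_def)
    ultimately show "eigenvalue ?A \<mu>" by (auto simp: eigenvalue_def eigenvector_def)
  qed
qed

text \<open>This makes the \<open>Max\<close> in \<open>rho_alpha\<close> meaningful. A complex
  eigenvalue exists; the Hermitian form of its eigenvector \<open>z\<close> is both real and
  \<open>\<mu>\<close> times the squared norm, so \<open>\<mu>\<close> is real, and the real or the
  imaginary part of \<open>z\<close> is a real eigenvector.\<close>

lemma symmetric_eigenvalues_finite_nonempty:
  fixes a :: "'a \<Rightarrow> 'a \<Rightarrow> real"
  assumes "finite V" "V \<noteq> {}" and sym: "\<And>u v. a u v = a v u"
  defines "\<Lambda> \<equiv> {\<mu>. \<exists>x. (\<exists>v\<in>V. x v \<noteq> 0) \<and> (\<forall>v\<in>V. (\<Sum>u\<in>V. a v u * x u) = \<mu> * x v)}"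
  shows "finite \<Lambda>" "\<Lambda> \<noteq> {}"
proof -
  define n where "n = card V"
  obtain f where f: "bij_betw f {0..<n} V" using assms(1) n_def ex_bij_betw_nat_finite by blast
  have "\<Lambda> = spectrum (mat n n (\<lambda>(i, j). a (f i) (f j)))"
    unfolding \<Lambda>_def spectrum_def using eigenvalue_mat_iff[OF f, of a] by auto
  then show "finite \<Lambda>" using card_finite_spectrum(1)[OF mat_carrier] by simp
  have "n \<noteq> 0" using assms by (simp add: n_def)
  then have "spectrum (mat n n (\<lambda>(i, j). complex_of_real (a (f i) (f j)))) \<noteq> {}"
    by (intro spectrum_non_empty[of _ n]) auto
  then obtain \<mu> where "eigenvalue (mat n n (\<lambda>(i, j). complex_of_real (a (f i) (f j)))) \<mu>"
    unfolding spectrum_def by blast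
  then obtain z where z: "\<exists>v\<in>V. z v \<noteq> 0"
    "\<And>v. v \<in> V \<Longrightarrow> (\<Sum>u\<in>V. complex_of_real (a v u) * z u) = \<mu> * z v"
    using eigenvalue_mat_iff[OF f, of "\<lambda>u v. complex_of_real (a u v)"] by blast
  define T where "T = (\<Sum>v\<in>V. \<Sum>u\<in>V. complex_of_real (a v u) * z u * cnj (z v))"
  define N where "N = (\<Sum>v\<in>V. (cmod (z v))\<^sup>2)"
  have "T = (\<Sum>v\<in>V. (\<Sum>u\<in>V. complex_of_real (a v u) * z u) * cnj (z v))"
    unfolding T_def by (simp add: sum_distrib_right)
  also have "\<dots> = (\<Sum>v\<in>V. \<mu> * of_real ((cmod (z v))\<^sup>2))"
    using z(2) by (intro sum.cong) (auto simp: complex_norm_square mult_ac simp del: of_real_power)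
  finally have T: "T = \<mu> * of_real N" by (simp add: N_def sum_distrib_left)
  have "cnj T = (\<Sum>v\<in>V. \<Sum>u\<in>V. complex_of_real (a u v) * z v * cnj (z u))"
    unfolding T_def by (simp add: cnj_sum mult_ac sym)
  also have "\<dots> = T" unfolding T_def by (rule sum.swap)
  finally have "cnj \<mu> * of_real N = \<mu> * of_real N" using T by (metis complex_cnj_complex_of_real complex_cnj_mult)
  moreover have "N > 0"
    unfolding N_def using z(1) assms(1) by (auto intro!: sum_pos2)
  ultimately have "cnj \<mu> = \<mu>" by simp
  then have \<mu>: "\<mu> = of_real (Re \<mu>)" by (metis Reals_cnj_iff of_real_Re)
  define m where "m = Re \<mu>"
  have eq: "(\<Sum>u\<in>V. of_real (a v u) * z u) = of_real m * z v" if "v \<in> V" for v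
    using z(2)[OF that] \<mu> by (simp add: m_def)
  have re: "(\<Sum>u\<in>V. a v u * Re (z u)) = m * Re (z v)" if "v \<in> V" for v
    using arg_cong[OF eq[OF that], of Re] by simp
  have im: "(\<Sum>u\<in>V. a v u * Im (z u)) = m * Im (z v)" if "v \<in> V" for v
    using arg_cong[OF eq[OF that], of Im] by simp
  consider "\<exists>v\<in>V. Re (z v) \<noteq> 0" | "\<exists>v\<in>V. Im (z v) \<noteq> 0"
    using z(1) complex_eq_iff by auto
  then have "m \<in> \<Lambda>"
  proof cases
    case 1
    then show ?thesis unfolding \<Lambda>_def using re by (intro CollectI exI[of _ "\<lambda>v. Re (z v)"]) blast
  next
    case 2
    then show ?thesis unfolding \<Lambda>_def using im by (intro CollectI exI[of _ "\<lambda>v. Im (z v)"]) blast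
  qed
  then show "\<Lambda> \<noteq> {}" by blast
qed

text \<open>Expanding the square gives a cross term and two terms that become equal when the double
  sum is swapped. For positive \<open>y\<close> and nonnegative entries the right-hand side is
  nonnegative, so the row quotients of \<open>y\<close> control the quadratic form at every
  \<open>x\<close>.\<close>

lemma ground_state_identity:
  fixes a :: "'a \<Rightarrow> 'a \<Rightarrow> real"
  assumes sym: "\<And>u v. a u v = a v u" and y: "\<And>v. v \<in> V \<Longrightarrow> y v \<noteq> 0"
  shows "(\<Sum>v\<in>V. (x v)\<^sup>2 * (\<Sum>u\<in>V. a v u * y u) / y v) - (\<Sum>v\<in>V. x v * (\<Sum>u\<in>V. a v u * x u)) =
    (\<Sum>v\<in>V. \<Sum>u\<in>V. a v u * y v * y u * (x v / y v - x u / y u)\<^sup>2) / 2"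
proof -
  define P where "P = (\<Sum>v\<in>V. \<Sum>u\<in>V. (x v)\<^sup>2 * a v u * y u / y v)"
  define X where "X = (\<Sum>v\<in>V. \<Sum>u\<in>V. x v * a v u * x u)"
  have "(\<Sum>v\<in>V. \<Sum>u\<in>V. a v u * y v * y u * (x v / y v - x u / y u)\<^sup>2) =
    (\<Sum>v\<in>V. \<Sum>u\<in>V. (x v)\<^sup>2 * a v u * y u / y v + (x u)\<^sup>2 * a u v * y v / y u - 2 * (x v * a v u * x u))"
  proof (intro sum.cong refl)
    fix v u assume "v \<in> V" "u \<in> V"
    then show "a v u * y v * y u * (x v / y v - x u / y u)\<^sup>2 =
      (x v)\<^sup>2 * a v u * y u / y v + (x u)\<^sup>2 * a u v * y v / y u - 2 * (x v * a v u * x u)"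
      using y[of u] y[of v] sym[of u v] by (simp add: field_simps power2_eq_square)
  qed
  also have "\<dots> = P + (\<Sum>v\<in>V. \<Sum>u\<in>V. (x u)\<^sup>2 * a u v * y v / y u) - 2 * X"
    by (simp add: P_def X_def sum.distrib sum_subtractf sum_distrib_left)
  also have "(\<Sum>v\<in>V. \<Sum>u\<in>V. (x u)\<^sup>2 * a u v * y v / y u) = P"
    unfolding P_def by (rule sum.swap)
  finally have "(\<Sum>v\<in>V. \<Sum>u\<in>V. a v u * y v * y u * (x v / y v - x u / y u)\<^sup>2) = 2 * (P - X)" by simp
  moreover have "P = (\<Sum>v\<in>V. (x v)\<^sup>2 * (\<Sum>u\<in>V. a v u * y u) / y v)"
    unfolding P_def by (simp add: sum_distrib_left sum_divide_distrib mult_ac)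
  moreover have "X = (\<Sum>v\<in>V. x v * (\<Sum>u\<in>V. a v u * x u))"
    unfolding X_def by (simp add: sum_distrib_left mult_ac)
  ultimately show ?thesis by simp
qed

text \<open>The Collatz-Wielandt upper bound: drop the nonnegative sum in
  \<open>ground_state_identity\<close> and bound each row quotient by \<open>l\<close>.\<close>

lemma quadratic_form_le:
  fixes a :: "'a \<Rightarrow> 'a \<Rightarrow> real"
  assumes sym: "\<And>u v. a u v = a v u" and nn: "\<And>u v. 0 \<le> a u v"
    and y: "\<And>v. v \<in> V \<Longrightarrow> 0 < y v" and le: "\<And>v. v \<in> V \<Longrightarrow> (\<Sum>u\<in>V. a v u * y u) \<le> l * y v"
  shows "(\<Sum>v\<in>V. x v * (\<Sum>u\<in>V. a v u * x u)) \<le> l * (\<Sum>v\<in>V. (x v)\<^sup>2)"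
proof -
  have "0 \<le> (\<Sum>v\<in>V. \<Sum>u\<in>V. a v u * y v * y u * (x v / y v - x u / y u)\<^sup>2) / 2"
    using nn y by (intro divide_nonneg_nonneg sum_nonneg mult_nonneg_nonneg) (auto intro: less_imp_le)
  then have "(\<Sum>v\<in>V. x v * (\<Sum>u\<in>V. a v u * x u)) \<le> (\<Sum>v\<in>V. (x v)\<^sup>2 * (\<Sum>u\<in>V. a v u * y u) / y v)"
    using ground_state_identity[of a V y x, OF sym] y by (simp add: less_imp_neq[symmetric])
  also have "\<dots> \<le> (\<Sum>v\<in>V. l * (x v)\<^sup>2)"
  proof (rule sum_mono)
    fix v assume v: "v \<in> V"
    have "(x v)\<^sup>2 * (\<Sum>u\<in>V. a v u * y u) \<le> (x v)\<^sup>2 * (l * y v)"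
      using le[OF v] by (rule mult_left_mono) simp
    then show "(x v)\<^sup>2 * (\<Sum>u\<in>V. a v u * y u) / y v \<le> l * (x v)\<^sup>2"
      using y[OF v] by (simp add: divide_le_eq mult_ac)
  qed
  also have "\<dots> = l * (\<Sum>v\<in>V. (x v)\<^sup>2)" by (simp add: sum_distrib_left)
  finally show ?thesis .
qed

text \<open>Equality in the Collatz--Wielandt bound forces \<open>x / y\<close> to be constant along edges.\<close>

lemma quadratic_form_less:
  fixes a :: "'a \<Rightarrow> 'a \<Rightarrow> real"
  assumes fin: "finite V" and sym: "\<And>u v. a u v = a v u" and nn: "\<And>u v. 0 \<le> a u v"
    and y: "\<And>v. v \<in> V \<Longrightarrow> 0 < y v" and le: "\<And>v. v \<in> V \<Longrightarrow> (\<Sum>u\<in>V. a v u * y u) \<le> l * y v"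
    and w: "w \<in> V" "(\<Sum>u\<in>V. a w u * y u) < l * y w"
    and conn: "\<And>u. u \<in> V \<Longrightarrow> (\<lambda>u v. u \<in> V \<and> v \<in> V \<and> 0 < a u v)\<^sup>*\<^sup>* u w"
    and x: "z \<in> V" "x z \<noteq> 0"
  shows "(\<Sum>v\<in>V. x v * (\<Sum>u\<in>V. a v u * x u)) < l * (\<Sum>v\<in>V. (x v)\<^sup>2)"
proof -
  define D where "D = (\<Sum>v\<in>V. \<Sum>u\<in>V. a v u * y v * y u * (x v / y v - x u / y u)\<^sup>2)"
  define P where "P = (\<Sum>v\<in>V. (x v)\<^sup>2 * (\<Sum>u\<in>V. a v u * y u) / y v)"
  have nonneg: "0 \<le> a v u * y v * y u * (x v / y v - x u / y u)\<^sup>2" if "u \<in> V" "v \<in> V" for u v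
    using nn y that by (intro mult_nonneg_nonneg) (auto intro: less_imp_le)
  have D0: "0 \<le> D" unfolding D_def using nonneg by (intro sum_nonneg) auto
  have id: "(\<Sum>v\<in>V. x v * (\<Sum>u\<in>V. a v u * x u)) = P - D / 2"
    using ground_state_identity[of a V y x, OF sym] y
    by (simp add: less_imp_neq[symmetric] P_def D_def)
  have le': "(x v)\<^sup>2 * (\<Sum>u\<in>V. a v u * y u) / y v \<le> l * (x v)\<^sup>2" if v: "v \<in> V" for v
  proof -
    have "(x v)\<^sup>2 * (\<Sum>u\<in>V. a v u * y u) \<le> (x v)\<^sup>2 * (l * y v)"
      using le[OF v] by (rule mult_left_mono) simp
    then show ?thesis using y[OF v] by (simp add: divide_le_eq mult_ac)
  qed
  then have P: "P \<le> l * (\<Sum>v\<in>V. (x v)\<^sup>2)"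
    unfolding P_def sum_distrib_left by (rule sum_mono)
  show ?thesis
  proof (cases "D = 0")
    case False
    then show ?thesis using id P D0 by simp
  next
    case True
    have step: "x u / y u = x v / y v" if "u \<in> V \<and> v \<in> V \<and> 0 < a u v" for u v
    proof -
      have "(\<Sum>t\<in>V. a u t * y u * y t * (x u / y u - x t / y t)\<^sup>2) = 0"
        using True that fin nonneg unfolding D_def
        by (subst (asm) sum_nonneg_eq_0_iff) (auto intro!: sum_nonneg)
      then have "\<forall>t\<in>V. a u t * y u * y t * (x u / y u - x t / y t)\<^sup>2 = 0"
        using that nonneg by (subst (asm) sum_nonneg_eq_0_iff[OF fin]) blast+
      then have "a u v * y u * y v * (x u / y u - x v / y v)\<^sup>2 = 0" using that by blast
      then show ?thesis using that y[of u] y[of v] by auto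
    qed
    \<comment> \<open>The ratio at \<open>z\<close> is nonzero and travels to \<open>w\<close>, so
      the strict row at \<open>w\<close> enters with positive weight.\<close>
    have "x z / y z = x w / y w" using conn[OF x(1)]
      by (induction rule: rtranclp_induct) (use step in auto)
    then have "x w \<noteq> 0" using x y by force
    then have "(x w)\<^sup>2 * (\<Sum>u\<in>V. a w u * y u) < (x w)\<^sup>2 * (l * y w)" using w(2) by simp
    then have "(x w)\<^sup>2 * (\<Sum>u\<in>V. a w u * y u) / y w < l * (x w)\<^sup>2"
      using y[OF w(1)] by (simp add: divide_less_eq mult_ac)
    then have "P < (\<Sum>v\<in>V. l * (x v)\<^sup>2)"
      unfolding P_def using le' w(1) fin by (intro sum_strict_mono_ex1) blast+
    then show ?thesis using id True by (simp add: sum_distrib_left)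
  qed
qed

section \<open>Spectral bounds for the alpha-matrix\<close>

lemma A_alpha_sym: "simple_graph V E \<Longrightarrow> A_alpha \<alpha> V E u v = A_alpha \<alpha> V E v u"
  by (auto simp: A_alpha_def simple_graph_def)

lemma A_alpha_nonneg: "0 \<le> \<alpha> \<Longrightarrow> \<alpha> \<le> 1 \<Longrightarrow> 0 \<le> A_alpha \<alpha> V E u v"
  by (simp add: A_alpha_def)

lemma A_alpha_apply:
  assumes "finite V" "v \<in> V"
  shows "(\<Sum>u\<in>V. A_alpha \<alpha> V E v u * y u) =
    \<alpha> * real (Defs.degree V E v) * y v + (1 - \<alpha>) * (\<Sum>u\<in>{u\<in>V. E v u}. y u)"
proof -
  have "(\<Sum>u\<in>V. A_alpha \<alpha> V E v u * y u) =
    (\<Sum>u\<in>V. (if v = u then \<alpha> * real (Defs.degree V E v) * y u else 0) + (1 - \<alpha>) * (if E v u then y u else 0))"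
    by (intro sum.cong) (auto simp: A_alpha_def algebra_simps)
  also have "\<dots> = \<alpha> * real (Defs.degree V E v) * y v + (1 - \<alpha>) * (\<Sum>u\<in>V. if E v u then y u else 0)"
    using assms by (simp add: sum.distrib sum_distrib_left)
  also have "(\<Sum>u\<in>V. if E v u then y u else 0) = (\<Sum>u\<in>{u\<in>V. E v u}. y u)"
    using assms(1) by (simp add: sum.inter_filter)
  finally show ?thesis .
qed

lemma A_alpha_eigenvalues_finite_nonempty:
  assumes "simple_graph V E" "V \<noteq> {}"
  shows "finite (A_alpha_eigenvalues \<alpha> V E)" "A_alpha_eigenvalues \<alpha> V E \<noteq> {}"
  using symmetric_eigenvalues_finite_nonempty[of V "A_alpha \<alpha> V E"] assms A_alpha_sym[OF assms(1)]
  unfolding A_alpha_eigenvalues_def by (auto simp: simple_graph_def)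

lemma rho_alpha_eigenvector:
  assumes "simple_graph V E" "V \<noteq> {}"
  obtains x where "\<exists>v\<in>V. x v \<noteq> 0"
    "(\<Sum>v\<in>V. x v * (\<Sum>u\<in>V. A_alpha \<alpha> V E v u * x u)) = rho_alpha \<alpha> V E * (\<Sum>v\<in>V. (x v)\<^sup>2)"
    "(\<Sum>v\<in>V. (x v)\<^sup>2) > 0"
proof -
  have "rho_alpha \<alpha> V E \<in> A_alpha_eigenvalues \<alpha> V E"
    unfolding rho_alpha_def using A_alpha_eigenvalues_finite_nonempty[OF assms] by (rule Max_in)
  then obtain x where x: "\<exists>v\<in>V. x v \<noteq> 0"
    "\<And>v. v \<in> V \<Longrightarrow> (\<Sum>u\<in>V. A_alpha \<alpha> V E v u * x u) = rho_alpha \<alpha> V E * x v"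
    unfolding A_alpha_eigenvalues_def by blast
  have "(\<Sum>v\<in>V. x v * (\<Sum>u\<in>V. A_alpha \<alpha> V E v u * x u)) = rho_alpha \<alpha> V E * (\<Sum>v\<in>V. (x v)\<^sup>2)"
    using x(2) by (simp add: sum_distrib_left power2_eq_square mult_ac)
  moreover have "(\<Sum>v\<in>V. (x v)\<^sup>2) > 0"
    using x(1) assms(1) by (auto simp: simple_graph_def intro!: sum_pos2)
  ultimately show ?thesis using that x(1) by blast
qed

text \<open>The two end points are combined as quadratic forms at one eigenvector \<open>x\<close>
  for \<open>\<alpha>\<close>; therefore the test vectors \<open>y\<close> and \<open>z\<close> need
  not be related.\<close>

lemma rho_alpha_le_convex:
  assumes G: "simple_graph V E" "V \<noteq> {}" and \<alpha>: "0 \<le> \<alpha>" "\<alpha> \<le> 1/2"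
    and y: "\<And>v. v \<in> V \<Longrightarrow> 0 < y v" "\<And>v. v \<in> V \<Longrightarrow> (\<Sum>u\<in>V. A_alpha 0 V E v u * y u) \<le> l * y v"
    and z: "\<And>v. v \<in> V \<Longrightarrow> 0 < z v" "\<And>v. v \<in> V \<Longrightarrow> (\<Sum>u\<in>V. A_alpha (1/2) V E v u * z u) \<le> k * z v"
  shows "rho_alpha \<alpha> V E \<le> (1 - 2 * \<alpha>) * l + 2 * \<alpha> * k"
proof -
  obtain x where "\<exists>v\<in>V. x v \<noteq> 0"
    and x: "(\<Sum>v\<in>V. x v * (\<Sum>u\<in>V. A_alpha \<alpha> V E v u * x u)) = rho_alpha \<alpha> V E * (\<Sum>v\<in>V. (x v)\<^sup>2)"
    and pos: "(\<Sum>v\<in>V. (x v)\<^sup>2) > 0"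
    by (rule rho_alpha_eigenvector[OF G])
  define r where "r a v = (\<Sum>u\<in>V. A_alpha a V E v u * x u)" for a v
  define N where "N = (\<Sum>v\<in>V. (x v)\<^sup>2)"
  have "(\<Sum>v\<in>V. x v * r 0 v) \<le> l * N" unfolding r_def N_def
    by (rule quadratic_form_le[where y = y])
      (rule A_alpha_sym[OF G(1)], rule A_alpha_nonneg, simp, simp, rule y(1), assumption, rule y(2), assumption)
  moreover have "(\<Sum>v\<in>V. x v * r (1/2) v) \<le> k * N" unfolding r_def N_def
    by (rule quadratic_form_le[where y = z])
      (rule A_alpha_sym[OF G(1)], rule A_alpha_nonneg, simp, simp, rule z(1), assumption, rule z(2), assumption)
  moreover have "(\<Sum>v\<in>V. x v * r \<alpha> v) =
    (1 - 2 * \<alpha>) * (\<Sum>v\<in>V. x v * r 0 v) + 2 * \<alpha> * (\<Sum>v\<in>V. x v * r (1/2) v)"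
  proof -
    have row: "r \<alpha> v = (1 - 2 * \<alpha>) * r 0 v + 2 * \<alpha> * r (1/2) v" for v
    proof -
      have "r \<alpha> v =
        (\<Sum>u\<in>V. (1 - 2 * \<alpha>) * (A_alpha 0 V E v u * x u) + 2 * \<alpha> * (A_alpha (1/2) V E v u * x u))"
        unfolding r_def by (intro sum.cong refl) (simp add: A_alpha_def algebra_simps)
      then show ?thesis by (simp only: r_def sum.distrib sum_distrib_left)
    qed
    have "(\<Sum>v\<in>V. x v * r \<alpha> v) =
      (\<Sum>v\<in>V. (1 - 2 * \<alpha>) * (x v * r 0 v) + 2 * \<alpha> * (x v * r (1/2) v))"
      by (intro sum.cong refl) (subst row, simp only: distrib_left mult_ac)
    then show ?thesis by (simp only: sum.distrib sum_distrib_left)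
  qed
  ultimately have "(\<Sum>v\<in>V. x v * r \<alpha> v) \<le> (1 - 2 * \<alpha>) * (l * N) + 2 * \<alpha> * (k * N)"
    using \<alpha> by (simp only:) (intro add_mono mult_left_mono, auto)
  then have "rho_alpha \<alpha> V E * N \<le> ((1 - 2 * \<alpha>) * l + 2 * \<alpha> * k) * N"
    using x by (simp add: r_def N_def algebra_simps)
  then show ?thesis using pos by (simp add: N_def)
qed

lemma rho_alpha_ge:
  assumes "simple_graph V E" and y: "\<exists>v\<in>V. y v \<noteq> 0"
    "\<And>v. v \<in> V \<Longrightarrow> (\<Sum>u\<in>V. A_alpha \<alpha> V E v u * y u) = l * y v"
  shows "l \<le> rho_alpha \<alpha> V E"
proof -
  have "l \<in> A_alpha_eigenvalues \<alpha> V E" unfolding A_alpha_eigenvalues_def using y by blast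
  moreover have "V \<noteq> {}" using y(1) by blast
  ultimately show ?thesis
    unfolding rho_alpha_def using A_alpha_eigenvalues_finite_nonempty(1)[OF assms(1)] by (simp add: Max_ge)
qed

text \<open>The right-hand side is the chord of the convex function \<open>c / (K - c)\<close> from
  \<open>c = 1\<close> to \<open>c = M\<close>. Its slope up to \<open>c\<close> is
  \<open>K / ((K - c) * (K - 1))\<close>, which increases with \<open>c\<close>.\<close>

lemma chord_bound:
  fixes c K M :: real
  assumes "1 \<le> c" "c \<le> M" "M < K"
  shows "c / (K - c) \<le> 1 / (K - 1) + (c - 1) * (K / ((K - M) * (K - 1)))"
proof -
  have "c / (K - c) = 1 / (K - 1) + (c - 1) * (K / ((K - c) * (K - 1)))"
    using assms by (simp add: divide_simps) (simp add: algebra_simps)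
  moreover have "K / ((K - c) * (K - 1)) \<le> K / ((K - M) * (K - 1))"
    using assms by (intro divide_left_mono mult_right_mono mult_pos_pos) auto
  then have "(c - 1) * (K / ((K - c) * (K - 1))) \<le> (c - 1) * (K / ((K - M) * (K - 1)))"
    using assms by (intro mult_left_mono) auto
  ultimately show ?thesis by simp
qed

text \<open>The vector is the Perron vector of the join of a clique on \<open>S\<close> with the disjoint cliques on
  the classes, up to the hub equation; convexity of \<open>c / (K - c)\<close> bounds the hub equation without
  knowing the class sizes.\<close>

lemma clique_join_vector:
  fixes \<alpha> l M :: real
  assumes G: "simple_graph V E" and \<alpha>: "0 \<le> \<alpha>" "\<alpha> \<le> 1/2"
    and S: "S \<subseteq> V" "S \<noteq> {}" and part: "partition_on (V - S) \<C>"
    and edge: "\<And>u v. E u v \<Longrightarrow> u \<in> S \<or> v \<in> S \<or> (\<exists>C\<in>\<C>. u \<in> C \<and> v \<in> C)"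
    and M: "\<And>C. C \<in> \<C> \<Longrightarrow> real (card C) \<le> M"
    and n: "n = real (card V)" and s: "s = real (card S)" and k: "s + 2 \<le> real (card \<C>)"
    and K: "K = l + 1 - \<alpha> * s" "M < K"
    and hub: "\<alpha> * (n - 1) + (1 - \<alpha>) * (s - 1) + (1 - \<alpha>)\<^sup>2 * s *
      ((s + 2) / (K - 1) + (n - 2 * s - 2) * (K / ((K - M) * (K - 1)))) \<le> l"
  shows "\<exists>y. (\<forall>v\<in>V. 0 < y v) \<and> (\<forall>v\<in>V. (\<Sum>u\<in>V. A_alpha \<alpha> V E v u * y u) \<le> l * y v)"
proof -
  have fin: "finite V" and irr: "\<not> E v v" for v using G by (auto simp: simple_graph_def)
  have finS: "finite S" using S fin by (meson finite_subset)
  have UC: "\<Union>\<C> = V - S" and dC: "disjoint \<C>" and neC: "{} \<notin> \<C>"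
    using part by (auto simp: partition_on_def)
  have finC: "finite \<C>" using part fin by (meson finite_Diff finite_elements)
  have finC': "finite C" if "C \<in> \<C>" for C
    using that UC fin by (metis Sup_upper finite_Diff finite_subset)
  have c1: "1 \<le> real (card C)" if "C \<in> \<C>" for C
    using finC'[OF that] neC that by (metis Suc_leI card_gt_0_iff of_nat_1 of_nat_le_iff One_nat_def)
  have s1: "1 \<le> s" using s S finS by (simp add: Suc_leI card_gt_0_iff)
  obtain C0 where "C0 \<in> \<C>" using k s1 by fastforce
  then have M1: "1 \<le> M" using c1 M by (meson order_trans)
  define cl where "cl v = (THE C. C \<in> \<C> \<and> v \<in> C)" for v
  have cl: "cl v = C" if "C \<in> \<C>" "v \<in> C" for C v
    unfolding cl_def using that dC by (intro the_equality) (auto simp: disjoint_def)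
  \<comment> \<open>This value makes the row of a vertex in a complete class of size
    \<open>c\<close> exact: \<open>(\<alpha> * s + c - 1) * t + (1 - \<alpha>) * s = l * t\<close>.
    Hence the shift \<open>K = l + 1 - \<alpha> * s\<close>.\<close>
  define t where "t C = (1 - \<alpha>) * s / (K - real (card C))" for C :: "'a set"
  define y where "y v = (if v \<in> S then 1 else t (cl v))" for v
  have tpos: "0 < t C" if "C \<in> \<C>" for C
    unfolding t_def using \<alpha> s1 M[OF that] K(2) by (intro divide_pos_pos mult_pos_pos) auto
  have inC: "\<exists>C\<in>\<C>. v \<in> C \<and> cl v = C" if "v \<in> V" "v \<notin> S" for v
    using that UC cl by blast
  have ypos: "0 < y v" if "v \<in> V" for v using inC[OF that] tpos by (auto simp: y_def)
  have yC: "y v = t C" if "C \<in> \<C>" "v \<in> C" for v C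
    using that UC cl[OF that] by (auto simp: y_def)
  define \<sigma> where "\<sigma> = K / ((K - M) * (K - 1))"
  have cVS: "real (card (V - S)) = n - s"
    using S finS fin n s by (simp add: card_Diff_subset card_mono)
  have "real (card (V - S)) = (\<Sum>C\<in>\<C>. real (card C))"
    using card_Union_disjoint[of \<C>] UC dC finC' by simp
  then have cC: "(\<Sum>C\<in>\<C>. real (card C)) = n - s" using cVS by simp
  have "(\<Sum>v\<in>V - S. y v) = (\<Sum>C\<in>\<C>. \<Sum>v\<in>C. y v)"
    unfolding UC[symmetric] using finC' dC
    by (subst sum.Union_disjoint) (auto simp: disjoint_def)
  also have "\<dots> = (1 - \<alpha>) * s * (\<Sum>C\<in>\<C>. real (card C) / (K - real (card C)))"
    using yC by (simp add: sum_distrib_left t_def mult_ac)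
  also have "\<dots> \<le> (1 - \<alpha>) * s * ((s + 2) / (K - 1) + (n - 2 * s - 2) * \<sigma>)"
  proof (rule mult_left_mono)
    have "(\<Sum>C\<in>\<C>. real (card C) / (K - real (card C))) \<le>
      (\<Sum>C\<in>\<C>. 1 / (K - 1) + (real (card C) - 1) * \<sigma>)"
      unfolding \<sigma>_def using c1 M K(2) by (intro sum_mono chord_bound) auto
    also have "\<dots> = real (card \<C>) * (1 / (K - 1)) + (n - s - real (card \<C>)) * \<sigma>"
      by (simp add: sum.distrib sum_subtractf sum_distrib_right[symmetric] cC)
    \<comment> \<open>Classes beyond \<open>s + 2\<close> only help: with the total size fixed, each
      further class trades a chord step \<open>\<sigma>\<close> for the smaller
      \<open>1 / (K - 1)\<close>.\<close>
    also have "\<dots> = (s + 2) / (K - 1) + (n - 2 * s - 2) * \<sigma> +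
        (real (card \<C>) - s - 2) * (1 / (K - 1) - \<sigma>)"
      by (simp add: algebra_simps diff_divide_distrib add_divide_distrib)
    also have "(real (card \<C>) - s - 2) * (1 / (K - 1) - \<sigma>) \<le> 0"
    proof (rule mult_nonneg_nonpos)
      have "1 / (K - 1) = (K - M) / ((K - M) * (K - 1))" using K(2) by simp
      also have "\<dots> \<le> \<sigma>" unfolding \<sigma>_def using K(2) M1 by (intro divide_right_mono) auto
      finally show "1 / (K - 1) - \<sigma> \<le> 0" by simp
    qed (use k in simp)
    finally show "(\<Sum>C\<in>\<C>. real (card C) / (K - real (card C))) \<le>
      (s + 2) / (K - 1) + (n - 2 * s - 2) * \<sigma>" by simp
  qed (use \<alpha> s1 in simp)
  finally have out: "(\<Sum>v\<in>V - S. y v) \<le> (1 - \<alpha>) * s * ((s + 2) / (K - 1) + (n - 2 * s - 2) * \<sigma>)" .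
  \<comment> \<open>As \<open>y\<close> is positive, enlarging a neighbourhood only raises the row,
    so every row may be computed in the full clique join.\<close>
  have bound: "(\<Sum>u\<in>V. A_alpha \<alpha> V E v u * y u) \<le>
    \<alpha> * real (card N) * y v + (1 - \<alpha>) * (\<Sum>u\<in>N. y u)"
    if "v \<in> V" "{u\<in>V. E v u} \<subseteq> N" "N \<subseteq> V" for v N
  proof -
    have fN: "finite N" using that(3) fin by (rule finite_subset)
    have "real (Defs.degree V E v) \<le> real (card N)"
      unfolding Defs.degree_def using card_mono[OF fN that(2)] by simp
    moreover have "(\<Sum>u\<in>{u\<in>V. E v u}. y u) \<le> (\<Sum>u\<in>N. y u)"
      using that fN ypos by (intro sum_mono2) (auto intro!: less_imp_le)
    ultimately show ?thesis
      unfolding A_alpha_apply[OF fin that(1)] using \<alpha> ypos[OF that(1)]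
      by (intro add_mono mult_mono mult_right_mono mult_left_mono) auto
  qed
  have "(\<Sum>u\<in>V. A_alpha \<alpha> V E v u * y u) \<le> l * y v" if v: "v \<in> V" for v
  proof (cases "v \<in> S")
    case True
    have "(\<Sum>u\<in>V. A_alpha \<alpha> V E v u * y u) \<le>
      \<alpha> * real (card (V - {v})) * y v + (1 - \<alpha>) * (\<Sum>u\<in>V - {v}. y u)"
      using v irr by (intro bound) auto
    also have "real (card (V - {v})) = n - 1"
      using v fin n card_gt_0_iff[of V] by (auto simp: of_nat_diff Suc_leI)
    also have "(\<Sum>u\<in>V - {v}. y u) = (\<Sum>u\<in>S - {v}. y u) + (\<Sum>u\<in>V - S. y u)"
    proof -
      have "V - {v} = (S - {v}) \<union> (V - S)" using S True by blast
      then show ?thesis using finS fin by (simp add: sum.union_disjoint disjoint_iff)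
    qed
    also have "(\<Sum>u\<in>S - {v}. y u) = s - 1"
      using True finS s card_gt_0_iff[of S] by (auto simp: y_def of_nat_diff Suc_leI)
    also have "y v = 1" using True by (simp add: y_def)
    also have "\<alpha> * (n - 1) * 1 + (1 - \<alpha>) * (s - 1 + (\<Sum>u\<in>V - S. y u)) \<le>
      \<alpha> * (n - 1) * 1 + (1 - \<alpha>) * (s - 1 + (1 - \<alpha>) * s * ((s + 2) / (K - 1) + (n - 2 * s - 2) * \<sigma>))"
      using out \<alpha> by (intro add_left_mono mult_left_mono) auto
    also have "\<dots> = \<alpha> * (n - 1) + (1 - \<alpha>) * (s - 1) +
      (1 - \<alpha>)\<^sup>2 * s * ((s + 2) / (K - 1) + (n - 2 * s - 2) * \<sigma>)"
      unfolding power2_eq_square by (simp only: distrib_left mult.assoc mult_1_right add.assoc)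
    also have "\<dots> \<le> l * 1" using hub unfolding \<sigma>_def by simp
    finally show ?thesis using True by (simp add: y_def)
  next
    case False
    then obtain C where C: "C \<in> \<C>" "v \<in> C" using inC v by blast
    define c where "c = real (card C)"
    have CV: "C \<subseteq> V - S" using C UC by blast
    have nb: "{u\<in>V. E v u} \<subseteq> S \<union> (C - {v})"
    proof
      fix u assume "u \<in> {u\<in>V. E v u}"
      then have "u \<noteq> v" "u \<in> S \<or> (\<exists>D\<in>\<C>. v \<in> D \<and> u \<in> D)" using edge[of v u] irr False by auto
      then show "u \<in> S \<union> (C - {v})" using C cl by blast
    qed
    have dj: "S \<inter> (C - {v}) = {}" using CV by blast
    have cc: "real (card (C - {v})) = c - 1"
      using C finC'[OF C(1)] c1[OF C(1)] by (simp add: c_def of_nat_diff)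
    have "(\<Sum>u\<in>V. A_alpha \<alpha> V E v u * y u) \<le>
      \<alpha> * real (card (S \<union> (C - {v}))) * y v + (1 - \<alpha>) * (\<Sum>u\<in>S \<union> (C - {v}). y u)"
      using v nb S CV by (intro bound) auto
    also have "real (card (S \<union> (C - {v}))) = s + c - 1"
      using finS finC'[OF C(1)] dj cc by (simp add: card_Un_disjoint s)
    also have "(\<Sum>u\<in>S \<union> (C - {v}). y u) = (\<Sum>u\<in>S. y u) + (\<Sum>u\<in>C - {v}. y u)"
      using finS finC'[OF C(1)] dj by (intro sum.union_disjoint) auto
    also have "(\<Sum>u\<in>S. y u) = s" by (simp add: y_def s)
    also have "(\<Sum>u\<in>C - {v}. y u) = (\<Sum>u\<in>C - {v}. y v)"
      using yC[OF C(1)] C(2) by (intro sum.cong) auto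
    also have "\<dots> = (c - 1) * y v" using cc by simp
    also have "\<alpha> * (s + c - 1) * y v + (1 - \<alpha>) * (s + (c - 1) * y v) =
      (\<alpha> * s + c - 1) * y v + (1 - \<alpha>) * s"
      by (simp add: algebra_simps)
    also have "(1 - \<alpha>) * s = (K - c) * y v"
      using yC[OF C] M[OF C(1)] K(2) by (simp add: t_def c_def)
    also have "(\<alpha> * s + c - 1) * y v + (K - c) * y v = l * y v"
      unfolding K(1) by (simp add: algebra_simps)
    finally show ?thesis .
  qed
  with ypos show ?thesis by (intro exI[of _ y]) blast
qed

section \<open>The extremal graph\<close>

lemma simple_graph_extremal: "simple_graph (extremal_V n) (extremal_E n)"
  by (auto simp: simple_graph_def extremal_V_def extremal_E_def)

lemma extremal_nbrs:
  assumes "n \<ge> 18"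
  shows "{u\<in>extremal_V n. extremal_E n 0 u} = {1..<n}"
    and "v \<in> {1..n-5} \<Longrightarrow> {u\<in>extremal_V n. extremal_E n v u} = insert 0 ({1..n-5} - {v})"
    and "v \<in> {n-4..n-2} \<Longrightarrow> {u\<in>extremal_V n. extremal_E n v u} = insert 0 ({n-4..n-2} - {v})"
    and "{u\<in>extremal_V n. extremal_E n (n - 1) u} = {0}"
  using assms by (auto simp: extremal_V_def extremal_E_def Defs.part_def split: if_splits)

text \<open>The positive eigenvector comes from the quotient matrix: eliminating the three cliques leaves
  a single equation for the eigenvalue at the hub, which has a root above the Rayleigh quotient
  \<open>n - 5 + 4\<alpha>/(n - 4)\<close> of the indicator of the clique on \<open>n - 4\<close> vertices.\<close>

lemma extremal_hub_root:
  fixes \<alpha> :: real and N :: real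
  assumes \<alpha>: "0 \<le> \<alpha>" "\<alpha> \<le> 1/2" and N: "N \<ge> 18"
  obtains l where "l > N - 5 + 4 * \<alpha> / (N - 4)"
    "\<alpha> * (N - 1) + (1 - \<alpha>)\<^sup>2 * ((N - 5) / (l + 6 - \<alpha> - N) + 3 / (l - 2 - \<alpha>) + 1 / (l - \<alpha>)) = l"
proof -
  define F where "F l = \<alpha> * (N - 1) +
    (1 - \<alpha>)\<^sup>2 * ((N - 5) / (l + 6 - \<alpha> - N) + 3 / (l - 2 - \<alpha>) + 1 / (l - \<alpha>)) - l" for l
  define \<delta> where "\<delta> = 4 * \<alpha> / (N - 4)"
  define l0 where "l0 = N - 5 + \<delta>"
  have \<delta>: "0 \<le> \<delta>" "\<delta> * (N - 4) = 4 * \<alpha>" using \<alpha> N by (auto simp: \<delta>_def)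
  have "\<delta> \<le> 1" using \<alpha> N by (simp add: \<delta>_def)
  have l0: "l0 \<ge> 13" using N \<delta> by (simp add: l0_def)
  \<comment> \<open>At \<open>l0\<close> the denominator of the large clique is
    \<open>1 - \<alpha> + \<delta>\<close>. Dropping the square of \<open>\<delta>\<close> makes hub
    and large clique balance exactly, by the choice of \<open>\<delta>\<close>; the two small
    cliques then make \<open>F l0\<close> positive.\<close>
  have "(1 - \<alpha>)\<^sup>2 / (1 - \<alpha> + \<delta>) \<ge> 1 - \<alpha> - \<delta>"
  proof -
    have "(1 - \<alpha> - \<delta>) * (1 - \<alpha> + \<delta>) \<le> (1 - \<alpha>)\<^sup>2" by (simp add: power2_eq_square algebra_simps)
    then show ?thesis using \<alpha> \<delta>(1) by (simp add: le_divide_eq)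
  qed
  then have "(N - 5) * (1 - \<alpha> - \<delta>) \<le> (N - 5) * ((1 - \<alpha>)\<^sup>2 / (1 - \<alpha> + \<delta>))"
    using N by (intro mult_left_mono) auto
  also have "\<dots> = (1 - \<alpha>)\<^sup>2 * ((N - 5) / (l0 + 6 - \<alpha> - N))"
    by (simp add: l0_def add.commute diff_add_eq mult.commute)
  finally have "(N - 5) * (1 - \<alpha> - \<delta>) \<le> (1 - \<alpha>)\<^sup>2 * ((N - 5) / (l0 + 6 - \<alpha> - N))" .
  moreover have "0 < (1 - \<alpha>)\<^sup>2 * (3 / (l0 - 2 - \<alpha>) + 1 / (l0 - \<alpha>))"
    using \<alpha> l0 by (intro mult_pos_pos add_pos_pos) auto
  moreover have "F l0 = \<alpha> * (N - 1) + (1 - \<alpha>)\<^sup>2 * ((N - 5) / (l0 + 6 - \<alpha> - N)) +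
      (1 - \<alpha>)\<^sup>2 * (3 / (l0 - 2 - \<alpha>) + 1 / (l0 - \<alpha>)) - l0"
    by (simp add: F_def algebra_simps)
  moreover have "\<alpha> * (N - 1) + (N - 5) * (1 - \<alpha> - \<delta>) - l0 = 0"
    using \<delta>(2) by (simp add: l0_def algebra_simps)
  ultimately have F0: "F l0 > 0" by linarith
  \<comment> \<open>\<open>2 * N\<close> is a crude right end for the intermediate value theorem;
    each of the three fractions is at most 1 there.\<close>
  have F1: "F (2 * N) \<le> 0"
  proof -
    define T where "T = (N - 5) / (2 * N + 6 - \<alpha> - N) + 3 / (2 * N - 2 - \<alpha>) + 1 / (2 * N - \<alpha>)"
    have "(N - 5) / (2 * N + 6 - \<alpha> - N) \<le> 1" "3 / (2 * N - 2 - \<alpha>) \<le> 1" "1 / (2 * N - \<alpha>) \<le> 1"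
      using \<alpha> N by auto
    then have "T \<le> 3" unfolding T_def by linarith
    moreover have "(1 - \<alpha>)\<^sup>2 \<le> 1" using \<alpha> by (simp add: power_le_one)
    moreover have "0 \<le> T" unfolding T_def using \<alpha> N by (intro add_nonneg_nonneg divide_nonneg_nonneg) auto
    ultimately have "(1 - \<alpha>)\<^sup>2 * T \<le> 3"
      by (metis mult.commute mult_left_le order_trans)
    moreover have "\<alpha> * (N - 1) \<le> 1/2 * (N - 1)" using \<alpha> N by (intro mult_right_mono) auto
    ultimately show ?thesis unfolding F_def T_def using N by argo
  qed
  have "continuous_on {l0..2 * N} F"
    unfolding F_def using \<alpha> \<delta>(1) N by (intro continuous_intros) (auto simp: l0_def)
  moreover have "l0 \<le> 2 * N" using N \<open>\<delta> \<le> 1\<close> by (simp add: l0_def)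
  ultimately obtain l where l: "l0 \<le> l" "F l = 0" using IVT2'[of F "2 * N" 0 l0] F0 F1 by auto
  with F0 have "l0 < l" by (cases "l = l0") auto
  with l(2) show ?thesis by (intro that[of l]) (auto simp: F_def l0_def \<delta>_def)
qed

text \<open>With one hub, \<open>t\<close> solves the clique rows exactly, and
  \<open>extremal_hub_root\<close> solves the hub row. The pair serves twice: \<open>l\<close> is an
  eigenvalue, so it is at most the spectral radius of the extremal graph, and its positive vector
  bounds the spectral radius of subgraphs.\<close>

lemma extremal_eigenvector:
  fixes \<alpha> :: real
  assumes \<alpha>: "0 \<le> \<alpha>" "\<alpha> \<le> 1/2" and n: "n \<ge> 18"
  obtains l y where "l > real n - 5 + 4 * \<alpha> / (real n - 4)" "\<And>v. v \<in> extremal_V n \<Longrightarrow> 0 < y v"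
    "\<And>v. v \<in> extremal_V n \<Longrightarrow>
      (\<Sum>u\<in>extremal_V n. A_alpha \<alpha> (extremal_V n) (extremal_E n) v u * y u) = l * y v"
proof -
  let ?V = "extremal_V n" and ?E = "extremal_E n"
  obtain l where l: "l > real n - 5 + 4 * \<alpha> / (real n - 4)" and
    root: "\<alpha> * (real n - 1) + (1 - \<alpha>)\<^sup>2 *
      ((real n - 5) / (l + 6 - \<alpha> - real n) + 3 / (l - 2 - \<alpha>) + 1 / (l - \<alpha>)) = l"
    using extremal_hub_root[OF \<alpha>, of "real n"] n by auto
  have l': "l > real n - 5"
    using l \<alpha> n divide_nonneg_nonneg[of "4 * \<alpha>" "real n - 4"] by linarith
  define t where "t c = (1 - \<alpha>) / (l + 1 - \<alpha> - c)" for c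
  define y where "y v = (if v = 0 then 1 else if v \<le> n - 5 then t (real n - 5)
    else if v \<le> n - 2 then t 3 else t 1)" for v
  have tpos: "0 < t c" if "c \<le> real n - 5" for c
    unfolding t_def using that l' \<alpha> by (intro divide_pos_pos) auto
  have "0 < y v" for v using tpos n by (auto simp: y_def)
  moreover have "(\<Sum>u\<in>?V. A_alpha \<alpha> ?V ?E v u * y u) = l * y v" if v: "v \<in> ?V" for v
  proof -
    have finV: "finite ?V" by (simp add: extremal_V_def)
    have clique: "\<alpha> * real (card (insert 0 (C - {v}))) * t c + (1 - \<alpha>) * (\<Sum>u\<in>insert 0 (C - {v}). y u) = l * t c"
      if "finite C" "0 \<notin> C" "v \<in> C" "real (card C) = c" "\<And>u. u \<in> C \<Longrightarrow> y u = t c" "c \<le> real n - 5" for C c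
    proof -
      have "card C > 0" using that card_gt_0_iff by blast
      then have c: "real (card (C - {v})) = c - 1" "real (card (insert 0 (C - {v}))) = c"
        using that by (auto simp: of_nat_diff Suc_leI)
      have "(\<Sum>u\<in>C - {v}. y u) = (c - 1) * t c" using that(5) c(1) by simp
      moreover have "y 0 = 1" by (simp add: y_def)
      ultimately have sm: "(\<Sum>u\<in>insert 0 (C - {v}). y u) = 1 + (c - 1) * t c"
        using that(1,2) by simp
      have "\<alpha> * real (card (insert 0 (C - {v}))) * t c + (1 - \<alpha>) * (\<Sum>u\<in>insert 0 (C - {v}). y u) =
        (c - 1 + \<alpha>) * t c + (1 - \<alpha>)"
        unfolding c sm by (simp add: algebra_simps)
      also have "(c - 1 + \<alpha>) * t c + (1 - \<alpha>) = (c - 1 + \<alpha>) * t c + (l + 1 - \<alpha> - c) * t c"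
        using that(6) l' \<alpha> by (simp add: t_def)
      also have "(c - 1 + \<alpha>) * t c + (l + 1 - \<alpha> - c) * t c = l * t c"
        by (simp add: algebra_simps)
      finally show ?thesis .
    qed
    consider "v = 0" | "v \<in> {1..n-5}" | "v \<in> {n-4..n-2}" | "v = n - 1"
      using v unfolding extremal_V_def atLeastAtMost_iff atLeastLessThan_iff by linarith
    then show ?thesis
    proof cases
      case 1
      have parts: "{1..<n} = {1..n-5} \<union> ({n-4..n-2} \<union> {n-1})" using n by auto
      have "(\<Sum>u\<in>{1..<n}. y u) = (\<Sum>u\<in>{1..n-5}. y u) + ((\<Sum>u\<in>{n-4..n-2}. y u) + (\<Sum>u\<in>{n-1}. y u))"
        unfolding parts using n by (subst sum.union_disjoint, simp, simp, force)+ simp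
      also have "(\<Sum>u\<in>{1..n-5}. y u) = (real n - 5) * t (real n - 5)"
        using n by (simp add: y_def of_nat_diff)
      also have "(\<Sum>u\<in>{n-4..n-2}. y u) = (\<Sum>u\<in>{n-4..n-2}. t 3)"
        using n by (intro sum.cong) (auto simp: y_def)
      also have "\<dots> = 3 * t 3" using n by simp
      also have "(\<Sum>u\<in>{n-1}. y u) = t 1" using n by (auto simp: y_def)
      finally have sum: "(\<Sum>u\<in>{1..<n}. y u) = (real n - 5) * t (real n - 5) + (3 * t 3 + t 1)" .
      have "(\<Sum>u\<in>?V. A_alpha \<alpha> ?V ?E 0 u * y u) =
        \<alpha> * (real n - 1) + (1 - \<alpha>) * ((real n - 5) * t (real n - 5) + (3 * t 3 + t 1))"
        using n v unfolding A_alpha_apply[OF finV v[unfolded 1]] Defs.degree_def extremal_nbrs(1)[OF n] sum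
        by (simp add: y_def of_nat_diff)
      also have "\<dots> = \<alpha> * (real n - 1) + (1 - \<alpha>)\<^sup>2 *
        ((real n - 5) / (l + 6 - \<alpha> - real n) + 3 / (l - 2 - \<alpha>) + 1 / (l - \<alpha>))"
      proof -
        define p q r where "p = 1 / (l + 6 - \<alpha> - real n)" and "q = 1 / (l - 2 - \<alpha>)" and "r = 1 / (l - \<alpha>)"
        have t: "t (real n - 5) = (1 - \<alpha>) * p" "t 3 = (1 - \<alpha>) * q" "t 1 = (1 - \<alpha>) * r"
          by (simp_all add: t_def p_def q_def r_def algebra_simps)
        have pqr: "(real n - 5) / (l + 6 - \<alpha> - real n) = (real n - 5) * p" "3 / (l - 2 - \<alpha>) = 3 * q"
          "1 / (l - \<alpha>) = r"
          by (simp_all add: p_def q_def r_def)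
        show ?thesis unfolding t pqr by (simp add: power2_eq_square algebra_simps)
      qed
      finally show ?thesis using root 1 by (simp add: y_def)
    next
      case 2
      have "y v = t (real n - 5)" using 2 by (simp add: y_def)
      then show ?thesis
        unfolding A_alpha_apply[OF finV v] Defs.degree_def extremal_nbrs(2)[OF n 2]
        using clique[of "{1..n-5}" "real n - 5"] 2 n by (simp add: y_def of_nat_diff)
    next
      case 3
      have *: "y u = t 3" if "u \<in> {n-4..n-2}" for u using that n by (auto simp: y_def)
      then show ?thesis
        unfolding A_alpha_apply[OF finV v] Defs.degree_def extremal_nbrs(3)[OF n 3] *[OF 3]
        using clique[of "{n-4..n-2}" 3] 3 n * by simp
    next
      case 4
      have *: "y (n - 1) = t 1" using n by (auto simp: y_def)
      have "insert 0 ({n - 1} - {v}) = {0}" using 4 by auto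
      then show ?thesis
        using clique[of "{n-1}" 1] 4 n * extremal_nbrs(4)[OF n]
        unfolding A_alpha_apply[OF finV v] Defs.degree_def by auto
    qed
  qed
  ultimately show ?thesis using that l by blast
qed

section \<open>Graphs without perfect matching\<close>

text \<open>The hub condition of \<open>clique_join_vector\<close> at \<open>\<alpha> = 0\<close>,
  with \<open>l = n - 5\<close> and \<open>M = n - 2 * s - 3\<close>, so that
  \<open>K = n - 4\<close> and \<open>K - M = 2 * s - 1\<close>.\<close>

lemma hub_inequality_adjacency:
  fixes n s :: nat
  assumes "s \<ge> 2" "n \<ge> 2 * s + 6" "n \<ge> 18"
  shows "real s - 1 + real s * ((real s + 2) / (real n - 5) +
    (real n - 2 * real s - 2) * ((real n - 4) / ((2 * real s - 1) * (real n - 5)))) \<le> real n - 5"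
proof -
  define S N where "S = real s" and "N = real n"
  have poly: "S * (S + 2) * (2 * S - 1) + S * (N - 2 * S - 2) * (N - 4) \<le> (N - 4 - S) * (N - 5) * (2 * S - 1)"
  proof (cases "s \<ge> 6")
    case True
    \<comment> \<open>From \<open>s = 6\<close> on, \<open>n \<ge> 2 * s + 6\<close> implies
      \<open>n \<ge> 18\<close>. Measured from the corner \<open>s = 6\<close>,
      \<open>n = 2 * s + 6\<close>, the difference of the two sides has only nonnegative
      coefficients.\<close>
    define t m where "t = S - 6" and "m = N - 2 * S - 6"
    have e: "S = t + 6" "N = 2 * t + 18 + m" by (auto simp: t_def m_def)
    have "0 \<le> t" "0 \<le> m" using True assms by (auto simp: t_def m_def S_def N_def)
    then have "0 \<le> 2*t*t*t + 33*t*t + 173*t + 4*t*t*m + 45*t*m + 280 + 123*m + t*m*m + 5*m*m"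
      by (intro add_nonneg_nonneg mult_nonneg_nonneg) auto
    also have "\<dots> = (N - 4 - S) * (N - 5) * (2 * S - 1) - (S * (S + 2) * (2 * S - 1) + S * (N - 2 * S - 2) * (N - 4))"
      unfolding e by (simp add: algebra_simps)
    finally show ?thesis by simp
  next
    case False
    define m where "m = N - 18"
    have e: "N = 18 + m" by (simp add: m_def)
    have "0 \<le> m" using assms by (simp add: m_def N_def)
    then have m: "0 \<le> m * m" "0 \<le> m" by auto
    have "s = 2 \<or> s = 3 \<or> s = 4 \<or> s = 5" using False assms by auto
    then show ?thesis unfolding e S_def using m by (auto simp: algebra_simps)
  qed
  have pos: "0 < 2 * S - 1" "0 < N - 5" using assms by (auto simp: S_def N_def)
  have "S - 1 + S * ((S + 2) / (N - 5) + (N - 2 * S - 2) * ((N - 4) / ((2 * S - 1) * (N - 5)))) =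
    S - 1 + (S * (S + 2) * (2 * S - 1) + S * (N - 2 * S - 2) * (N - 4)) / ((2 * S - 1) * (N - 5))"
    using pos by (simp add: divide_simps) (simp add: algebra_simps)
  also have "\<dots> \<le> S - 1 + (N - 4 - S)"
    using poly pos by (intro add_left_mono) (simp add: divide_le_eq mult_ac)
  finally show ?thesis by (simp add: S_def N_def)
qed

text \<open>The hub condition at \<open>\<alpha> = 1/2\<close>, half the signless Laplacian, again
  with \<open>l = n - 5\<close> and \<open>M = n - 2 * s - 3\<close>; now
  \<open>K - M = 3 * s / 2 - 1\<close>. At \<open>s = 6\<close>, \<open>n = 18\<close> the cleared
  polynomial inequality fails by 16, hence the exclusion.\<close>

lemma hub_inequality_signless:
  fixes n s :: nat
  assumes "s \<ge> 2" "n \<ge> 2 * s + 6" "n \<ge> 18" "s = 6 \<Longrightarrow> n \<noteq> 18"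
  defines "K \<equiv> real n - 4 - real s / 2"
  shows "(real n - 1) / 2 + (real s - 1) / 2 + real s / 4 * ((real s + 2) / (K - 1) +
    (real n - 2 * real s - 2) * (K / ((3 * real s / 2 - 1) * (K - 1)))) \<le> real n - 5"
proof -
  define S N where "S = real s" and "N = real n"
  have poly: "S * (S + 2) * (3 * S - 2) + S * (N - 2 * S - 2) * (2 * N - 8 - S)
    \<le> (N - 8 - S) * (3 * S - 2) * (2 * N - 10 - S)"
  proof (cases "s \<ge> 7")
    case True
    define t m where "t = S - 7" and "m = N - 2 * S - 6"
    have e: "S = t + 7" "N = 2 * t + 20 + m" by (auto simp: t_def m_def)
    have "0 \<le> t" "0 \<le> m" using True assms by (auto simp: t_def m_def S_def N_def)
    then have "0 \<le> 6*t*t*t + 92*t*t + 12*t*t*m + 390*t + 140*t*m + 288 + 396*m + 4*t*m*m + 24*m*m"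
      by (intro add_nonneg_nonneg mult_nonneg_nonneg) auto
    also have "\<dots> = (N - 8 - S) * (3 * S - 2) * (2 * N - 10 - S) -
      (S * (S + 2) * (3 * S - 2) + S * (N - 2 * S - 2) * (2 * N - 8 - S))"
      unfolding e by (simp add: algebra_simps)
    finally show ?thesis by simp
  next
    case False
    define m where "m = N - 18"
    have e: "N = 18 + m" by (simp add: m_def)
    have "0 \<le> m" using assms by (simp add: m_def N_def)
    then have m: "0 \<le> m * m" "0 \<le> m" by auto
    have m1: "16 \<le> m * (m * 20) + m * 268" if "s = 6"
    proof -
      have "1 \<le> m" using assms that by (simp add: m_def N_def)
      moreover have "m * (m * 20) = 20 * (m * m)" by simp
      ultimately show ?thesis using m(1) by linarith
    qed
    have "s = 2 \<or> s = 3 \<or> s = 4 \<or> s = 5 \<or> s = 6" using False assms by auto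
    then show ?thesis unfolding e S_def using m m1 by (auto simp: algebra_simps)
  qed
  have pos: "0 < 3 * S - 2" "0 < 2 * N - 10 - S" using assms by (auto simp: S_def N_def)
  have K: "K = (2 * N - 8 - S) / 2" "K - 1 = (2 * N - 10 - S) / 2" "3 * S / 2 - 1 = (3 * S - 2) / 2"
    by (simp_all add: K_def S_def N_def field_simps)
  define B where "B = S / 4 * ((S + 2) / (K - 1) + (N - 2 * S - 2) * (K / ((3 * S / 2 - 1) * (K - 1))))"
  have "B =
    (S * (S + 2) * (3 * S - 2) + S * (N - 2 * S - 2) * (2 * N - 8 - S)) / (2 * ((3 * S - 2) * (2 * N - 10 - S)))"
    unfolding B_def K using pos by (simp add: divide_simps) (simp add: algebra_simps)
  also have "\<dots> \<le> (N - 8 - S) / 2"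
    using poly pos by (simp add: divide_le_eq mult_ac)
  finally have "(N - 1) / 2 + (S - 1) / 2 + B \<le> N - 5" by (simp add: field_simps)
  then show ?thesis unfolding B_def S_def N_def .
qed

section \<open>Counting vertices of odd classes\<close>

lemma odd_class_card_ge_3:
  assumes "odd (card D)" "card D \<noteq> 1"
  shows "3 \<le> card D"
  using assms by (cases "card D = 0 \<or> card D = 2") auto

text \<open>Adding 2 to each singleton makes every odd class count at least 3, and at most
  \<open>s\<close> singletons are topped up: \<open>3 * (s + j) - 2 * s = s + 3 * j\<close>.\<close>

lemma sum_odd_classes_ge:
  assumes "finite \<O>" "\<And>D. D \<in> \<O> \<Longrightarrow> odd (card D)" "card {D\<in>\<O>. card D = 1} \<le> s" "s + j \<le> card \<O>"
  shows "s + 3 * j \<le> (\<Sum>D\<in>\<O>. card D)"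
proof -
  have "3 * card \<O> = (\<Sum>D\<in>\<O>. 3)" by simp
  also have "\<dots> \<le> (\<Sum>D\<in>\<O>. card D + (if card D = 1 then 2 else 0))"
    using odd_class_card_ge_3 assms(2) by (intro sum_mono) auto
  also have "\<dots> = (\<Sum>D\<in>\<O>. card D) + 2 * card {D\<in>\<O>. card D = 1}"
    using assms(1) by (simp add: sum.distrib sum.inter_filter[symmetric])
  finally show ?thesis using assms(3,4) by linarith
qed

text \<open>The union \<open>X\<close> of the singleton classes has all its neighbours in
  \<open>S\<close>. They miss \<open>X\<close>, so the binding condition applies and gives
  \<open>card X \<le> card S\<close>.\<close>

lemma one_binding_singletons_le:
  assumes G: "simple_graph V E" and "one_binding V E" and S: "S \<subseteq> V" and part: "partition_on (V - S) \<C>"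
    and edge: "\<And>u v. E u v \<Longrightarrow> u \<in> S \<or> v \<in> S \<or> (\<exists>C\<in>\<C>. u \<in> C \<and> v \<in> C)"
  shows "card {C\<in>\<C>. card C = 1} \<le> card S"
proof (cases "{C\<in>\<C>. card C = 1} = {}")
  case True
  then show ?thesis by (simp only: card.empty)
next
  case False
  define T where "T = {C\<in>\<C>. card C = 1}"
  define X where "X = \<Union>T"
  have fin: "finite V" using G by (simp add: simple_graph_def)
  have UC: "\<Union>\<C> = V - S" and dC: "disjoint \<C>" using part by (auto simp: partition_on_def)
  have "disjoint T" using dC by (auto simp: T_def disjoint_def)
  then have "card X = (\<Sum>C\<in>T. card C)"
    unfolding X_def by (intro card_Union_disjoint) (auto simp: T_def intro: card_ge_0_finite)
  then have cX: "card X = card T" by (simp add: T_def)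
  have XV: "X \<subseteq> V - S" using UC by (auto simp: X_def T_def)
  have "X \<noteq> {}"
  proof -
    obtain C where "C \<in> T" using False by (auto simp: T_def)
    moreover then have "C \<noteq> {}" by (auto simp: T_def)
    ultimately show ?thesis by (auto simp: X_def)
  qed
  have NS: "nbhd V E X \<subseteq> S"
  proof
    fix v assume "v \<in> nbhd V E X"
    then obtain x where x: "x \<in> X" "E x v" by (auto simp: nbhd_def)
    then obtain D where D: "D \<in> \<C>" "card D = 1" "x \<in> D" by (auto simp: X_def T_def)
    have "v \<notin> C" if "C \<in> \<C>" "x \<in> C" for C
    proof
      assume "v \<in> C"
      have "C = D" using that D dC by (auto simp: disjoint_def)
      then have "v = x" using \<open>v \<in> C\<close> D by (metis card_1_singletonE singletonD)
      then show False using x(2) G by (simp add: simple_graph_def)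
    qed
    then show "v \<in> S" using edge[OF x(2)] x(1) XV by blast
  qed
  have "nbhd V E X \<noteq> V" using NS XV \<open>X \<noteq> {}\<close> by blast
  then have "1 \<le> real (card (nbhd V E X)) / real (card X)"
    using assms(2) XV \<open>X \<noteq> {}\<close> unfolding one_binding_def by blast
  moreover have "0 < card X" using \<open>X \<noteq> {}\<close> XV fin by (meson card_gt_0_iff finite_Diff finite_subset)
  ultimately have "card X \<le> card (nbhd V E X)" by (simp add: le_divide_eq)
  also have "\<dots> \<le> card S" using NS S fin by (meson card_mono finite_subset)
  finally show ?thesis using cX by (simp add: T_def)
qed

text \<open>With \<open>S\<close> empty no walk could leave its class.\<close>

lemma connected_graph_separator_nonempty:
  assumes "simple_graph V E" "connected_graph V E" "partition_on (V - S) \<C>" "2 \<le> card \<C>"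
    and edge: "\<And>u v. E u v \<Longrightarrow> u \<in> S \<or> v \<in> S \<or> (\<exists>C\<in>\<C>. u \<in> C \<and> v \<in> C)"
  shows "S \<noteq> {}"
proof
  assume S: "S = {}"
  have UC: "\<Union>\<C> = V" and dC: "disjoint \<C>" and ne: "{} \<notin> \<C>" using assms(3) S by (auto simp: partition_on_def)
  obtain C D where CD: "C \<in> \<C>" "D \<in> \<C>" "C \<noteq> D"
    using assms(4) by (metis card_le_Suc0_iff_eq card_ge_0_finite not_less_eq_eq numeral_2_eq_2 Suc_le_lessD zero_less_Suc order_less_le_trans)
  then obtain u w where uw: "u \<in> C" "w \<in> D" using ne by (metis equals0I)
  have "E\<^sup>*\<^sup>* u w" using assms(2) uw CD UC by (auto simp: connected_graph_def)
  then have "w \<in> C"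
  proof (induction rule: rtranclp_induct)
    case (step v x)
    then show ?case using edge[of v x] S CD(1) dC by (auto simp: disjoint_def)
  qed (use uw in auto)
  then show False using uw CD dC by (auto simp: disjoint_def)
qed

text \<open>\<open>clique_join_vector\<close> is applied at both end points. For
  \<open>s = 1\<close> the general bound on class sizes would be \<open>n - 5\<close>, which the
  extremal graph attains; the sharper \<open>n - 6\<close> is what makes the estimate
  possible.\<close>

lemma rho_alpha_le_nonextremal:
  assumes G: "simple_graph V E" and \<alpha>: "0 \<le> \<alpha>" "\<alpha> \<le> 1/2"
    and S: "S \<subseteq> V" "S \<noteq> {}" and part: "partition_on (V - S) \<C>"
    and edge: "\<And>u v. E u v \<Longrightarrow> u \<in> S \<or> v \<in> S \<or> (\<exists>C\<in>\<C>. u \<in> C \<and> v \<in> C)"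
    and n: "card V = n" "even n" "n \<ge> 18" and k: "card S + 2 \<le> card \<C>" "2 * card S + 6 \<le> n"
    and M: "\<And>C. C \<in> \<C> \<Longrightarrow> card C + 2 * card S + 3 \<le> n"
      "\<And>C. card S = 1 \<Longrightarrow> C \<in> \<C> \<Longrightarrow> card C + 6 \<le> n"
  shows "rho_alpha \<alpha> V E \<le> real n - 5 + 4 * \<alpha> / (real n - 4)"
proof -
  define s where "s = card S"
  have "V \<noteq> {}" using n by auto
  have "s \<ge> 1" using S G by (simp add: s_def simple_graph_def Suc_leI card_gt_0_iff finite_subset)
  have k': "real s + 2 \<le> real (card \<C>)" using k(1) unfolding s_def by linarith
  have vec: "\<exists>y. (\<forall>v\<in>V. 0 < y v) \<and> (\<forall>v\<in>V. (\<Sum>u\<in>V. A_alpha a V E v u * y u) \<le> l * y v)"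
    if h: "0 \<le> a" "a \<le> 1/2" "\<And>C. C \<in> \<C> \<Longrightarrow> real (card C) \<le> m" "m < l + 1 - a * real s"
      "a * (real n - 1) + (1 - a) * (real s - 1) + (1 - a)\<^sup>2 * real s *
        ((real s + 2) / (l + 1 - a * real s - 1) + (real n - 2 * real s - 2) *
         ((l + 1 - a * real s) / ((l + 1 - a * real s - m) * (l + 1 - a * real s - 1)))) \<le> l" for a l m
  proof (rule clique_join_vector[OF G h(1,2) S part edge h(3) refl refl])
    show "real (card S) + 2 \<le> real (card \<C>)" using k' by (simp add: s_def)
    show "l + 1 - a * real (card S) = l + 1 - a * real (card S)" ..
    show "m < l + 1 - a * real (card S)" using h(4) by (simp add: s_def)
    show "a * (real (card V) - 1) + (1 - a) * (real (card S) - 1) + (1 - a)\<^sup>2 * real (card S) *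
      ((real (card S) + 2) / (l + 1 - a * real (card S) - 1) + (real (card V) - 2 * real (card S) - 2) *
       ((l + 1 - a * real (card S)) / ((l + 1 - a * real (card S) - m) * (l + 1 - a * real (card S) - 1)))) \<le> l"
      using h(5) unfolding n(1) s_def .
  qed
  have "\<exists>y z. (\<forall>v\<in>V. 0 < y v) \<and> (\<forall>v\<in>V. (\<Sum>u\<in>V. A_alpha 0 V E v u * y u) \<le> (real n - 5) * y v) \<and>
    (\<forall>v\<in>V. 0 < z v) \<and>
    (\<forall>v\<in>V. (\<Sum>u\<in>V. A_alpha (1/2) V E v u * z u) \<le> (real n - 5 + 2 / (real n - 4)) * z v)"
  proof -
    \<comment> \<open>At \<open>\<alpha> = 1/2\<close> all cases but one reach \<open>n - 5\<close>
      itself, below the target.\<close>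
    have upgrade: "(\<Sum>u\<in>V. A_alpha (1/2) V E v u * z u) \<le> (real n - 5 + 2 / (real n - 4)) * z v"
      if "(\<Sum>u\<in>V. A_alpha (1/2) V E v u * z u) \<le> (real n - 5) * z v" "0 < z v" for z v
    proof -
      have "(real n - 5) * z v \<le> (real n - 5 + 2 / (real n - 4)) * z v"
        using that(2) n(3) by (intro mult_right_mono) auto
      then show ?thesis using that(1) by linarith
    qed
    have "\<exists>y. (\<forall>v\<in>V. 0 < y v) \<and> (\<forall>v\<in>V. (\<Sum>u\<in>V. A_alpha 0 V E v u * y u) \<le> (real n - 5) * y v)"
    proof (cases "s = 1")
      case True
      have "real (card C) \<le> real n - 6" if "C \<in> \<C>" for C using M(2)[of C] True that s_def by linarith
      moreover have "3 / (real n - 5) + (real n - 4) * ((real n - 4) / (2 * (real n - 5))) \<le> real n - 5"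
      proof -
        define p where "p = real n - 18"
        have e: "real n = p + 18" and p: "0 \<le> p" "0 \<le> p * p" using n(3) by (auto simp: p_def)
        have "6 + (real n - 4) * (real n - 4) \<le> 2 * ((real n - 5) * (real n - 5))"
          unfolding e using p by (simp add: algebra_simps)
        then have "(6 + (real n - 4) * (real n - 4)) / (2 * (real n - 5)) \<le> real n - 5"
          using n(3) by (simp add: divide_le_eq) (simp add: algebra_simps)
        moreover have "3 / (real n - 5) + (real n - 4) * ((real n - 4) / (2 * (real n - 5))) =
          (6 + (real n - 4) * (real n - 4)) / (2 * (real n - 5))"
          using n(3) by (simp add: divide_simps) (simp add: algebra_simps)
        ultimately show ?thesis by simp
      qed
      ultimately show ?thesis using True n(3)
        by (intro vec[where m = "real n - 6"]) (auto simp: algebra_simps)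
    next
      case False
      have "real (card C) \<le> real n - 2 * real s - 3" if "C \<in> \<C>" for C
        using M(1)[OF that] unfolding s_def by linarith
      moreover have "real n - 5 + 1 - 0 * real s - (real n - 2 * real s - 3) = 2 * real s - 1" by simp
      moreover have "s \<ge> 2" using False \<open>s \<ge> 1\<close> by simp
      ultimately show ?thesis using hub_inequality_adjacency[of s n] k(2) n(3)
        by (intro vec[where m = "real n - 2 * real s - 3"]) (auto simp: s_def)
    qed
    moreover have "\<exists>z. (\<forall>v\<in>V. 0 < z v) \<and>
      (\<forall>v\<in>V. (\<Sum>u\<in>V. A_alpha (1/2) V E v u * z u) \<le> (real n - 5 + 2 / (real n - 4)) * z v)"
    proof -
      consider "s = 1" | "s = 6" "n = 18" | "s \<ge> 2" "s = 6 \<Longrightarrow> n \<noteq> 18" using \<open>s \<ge> 1\<close> by fastforce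
      then show ?thesis
      proof cases
        case 1
        have c: "real (card C) \<le> real n - 6" if "C \<in> \<C>" for C using M(2)[of C] 1 that s_def by linarith
        have h: "(real n - 1) / 2 + (3 / (real n - 11/2) + (real n - 4) *
          ((real n - 9/2) / (3/2 * (real n - 11/2)))) / 4 \<le> real n - 5"
        proof -
          define p where "p = real n - 18"
          have e: "real n = p + 18" and p: "0 \<le> p" "0 \<le> p * p" using n(3) by (auto simp: p_def)
          have "9 + (real n - 4) * (2 * real n - 9) \<le> 3 * (real n - 9) * (2 * real n - 11)"
            unfolding e using p by (simp add: algebra_simps)
          then have le: "(9 + (real n - 4) * (2 * real n - 9)) / (12 * (real n - 11/2)) \<le> (real n - 9) / 2"
            using n(3) by (simp add: divide_le_eq) (simp add: algebra_simps)
          have e1: "(3 / (real n - 11/2) + (real n - 4) *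
            ((real n - 9/2) / (3/2 * (real n - 11/2)))) / 4 =
            (9 + (real n - 4) * (2 * real n - 9)) / (12 * (real n - 11/2))"
            using n(3) by (simp add: divide_simps) (simp add: algebra_simps)
          have "(real n - 1) / 2 + B \<le> real n - 5" if "B \<le> (real n - 9) / 2" for B
            using that by (simp add: field_simps)
          from this[OF le] show ?thesis unfolding e1 .
        qed
        have K: "real n - 5 + 1 - 1/2 * real s = real n - 9/2" using 1 by simp
        have "\<exists>z. (\<forall>v\<in>V. 0 < z v) \<and> (\<forall>v\<in>V. (\<Sum>u\<in>V. A_alpha (1/2) V E v u * z u) \<le> (real n - 5) * z v)"
        proof (rule vec[where m = "real n - 6"], goal_cases)
          case 5
          then show ?case unfolding K using h 1 by (simp add: power2_eq_square)
        qed (use c 1 in auto)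
        then show ?thesis using upgrade by blast
      next
        case 2
        \<comment> \<open>The hub condition just fails for \<open>l = 13\<close>; the surplus
          \<open>2 / (n - 4) = 1/7\<close> in the target saves it.\<close>
        have "real (card C) \<le> 3" if "C \<in> \<C>" for C using M(1)[OF that] 2 unfolding s_def by linarith
        then show ?thesis using 2
          by (intro vec[where m = 3]) (auto simp: power2_eq_square)
      next
        case 3
        have c: "real (card C) \<le> real n - 2 * real s - 3" if "C \<in> \<C>" for C
          using M(1)[OF that] unfolding s_def by linarith
        define K where "K = real n - 4 - real s / 2"
        have K: "real n - 5 + 1 - 1/2 * real s = K" by (simp add: K_def)
        have KM: "K - (real n - 2 * real s - 3) = 3 * real s / 2 - 1" by (simp add: K_def)
        have "\<exists>z. (\<forall>v\<in>V. 0 < z v) \<and> (\<forall>v\<in>V. (\<Sum>u\<in>V. A_alpha (1/2) V E v u * z u) \<le> (real n - 5) * z v)"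
        proof (rule vec[where m = "real n - 2 * real s - 3"], goal_cases)
          case 5
          then show ?case unfolding K KM
            using hub_inequality_signless[OF 3(1) _ n(3) 3(2)] k(2)
            by (simp add: K_def s_def power2_eq_square)
        qed (use c 3 in auto)
        then show ?thesis using upgrade by blast
      qed
    qed
    ultimately show ?thesis by blast
  qed
  then obtain y z where y: "\<forall>v\<in>V. 0 < y v" "\<forall>v\<in>V. (\<Sum>u\<in>V. A_alpha 0 V E v u * y u) \<le> (real n - 5) * y v"
    and z: "\<forall>v\<in>V. 0 < z v"
      "\<forall>v\<in>V. (\<Sum>u\<in>V. A_alpha (1/2) V E v u * z u) \<le> (real n - 5 + 2 / (real n - 4)) * z v" by blast
  have "rho_alpha \<alpha> V E \<le> (1 - 2 * \<alpha>) * (real n - 5) + 2 * \<alpha> * (real n - 5 + 2 / (real n - 4))"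
    using y z by (intro rho_alpha_le_convex[OF G \<open>V \<noteq> {}\<close> \<alpha>, of y _ z]) auto
  also have "\<dots> = real n - 5 + 4 * \<alpha> / (real n - 4)" by (simp add: algebra_simps)
  finally show ?thesis .
qed

text \<open>Pulled back along \<open>f\<close>, the eigenvector \<open>y\<close> satisfies every row
  of the smaller graph with \<open>\<le>\<close>, strictly at \<open>a\<close>, where the entry for
  \<open>b\<close> is missing. Connectivity makes the bound strict through
  \<open>quadratic_form_less\<close>.\<close>

lemma rho_alpha_less_supergraph:
  assumes G: "simple_graph V E" and conn: "connected_graph V E" and \<alpha>: "0 \<le> \<alpha>" "\<alpha> < 1"
    and f: "bij_betw f V W" and H: "simple_graph W H"
    and sub: "\<And>u v. E u v \<Longrightarrow> H (f u) (f v)"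
    and new: "a \<in> V" "b \<in> V" "\<not> E a b" "H (f a) (f b)"
    and y: "\<And>v. v \<in> W \<Longrightarrow> 0 < y v"
      "\<And>v. v \<in> W \<Longrightarrow> (\<Sum>u\<in>W. A_alpha \<alpha> W H v u * y u) = l * y v"
  shows "rho_alpha \<alpha> V E < l"
proof -
  have fin: "finite V" "finite W" and EV: "\<And>u v. E u v \<Longrightarrow> u \<in> V \<and> v \<in> V"
    using G H by (auto simp: simple_graph_def)
  have ne: "V \<noteq> {}" using new by blast
  have fW: "f v \<in> W" if "v \<in> V" for v using that f by (auto simp: bij_betw_def)
  have inj: "inj_on f V" using f by (simp add: bij_betw_def)
  have deg: "Defs.degree V E v \<le> Defs.degree W H (f v)" if "v \<in> V" for v
  proof -
    have "card (f ` {u\<in>V. E v u}) \<le> card {w\<in>W. H (f v) w}"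
      using sub fW fin by (intro card_mono) auto
    moreover have "card (f ` {u\<in>V. E v u}) = card {u\<in>V. E v u}"
      using inj by (intro card_image) (auto simp: inj_on_def)
    ultimately show ?thesis by (simp add: Defs.degree_def)
  qed
  have entry: "A_alpha \<alpha> V E v u \<le> A_alpha \<alpha> W H (f v) (f u)" if "v \<in> V" "u \<in> V" for u v
    unfolding A_alpha_def
  proof (rule add_mono)
    have "f v = f u \<longleftrightarrow> v = u" using inj that by (auto simp: inj_on_def)
    then show "(if v = u then \<alpha> * real (Defs.degree V E v) else 0) \<le>
      (if f v = f u then \<alpha> * real (Defs.degree W H (f v)) else 0)"
      using deg[OF that(1)] \<alpha> by (auto intro!: mult_left_mono)
    show "(1 - \<alpha>) * (if E v u then 1 else 0) \<le> (1 - \<alpha>) * (if H (f v) (f u) then 1 else 0)"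
      using sub[of v u] \<alpha> by auto
  qed
  have row: "(\<Sum>u\<in>V. A_alpha \<alpha> W H (f v) (f u) * y (f u)) = l * y (f v)" if "v \<in> V" for v
    using sum.reindex_bij_betw[OF f, of "\<lambda>w. A_alpha \<alpha> W H (f v) w * y w"] y(2)[OF fW[OF that]] by simp
  have le: "(\<Sum>u\<in>V. A_alpha \<alpha> V E v u * y (f u)) \<le> l * y (f v)" if "v \<in> V" for v
    unfolding row[OF that, symmetric]
    using entry that y(1) fW by (intro sum_mono mult_right_mono) (auto intro: less_imp_le)
  have lt: "(\<Sum>u\<in>V. A_alpha \<alpha> V E a u * y (f u)) < l * y (f a)"
    unfolding row[OF new(1), symmetric]
  proof (rule sum_strict_mono_ex1)
    show "\<forall>u\<in>V. A_alpha \<alpha> V E a u * y (f u) \<le> A_alpha \<alpha> W H (f a) (f u) * y (f u)"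
      using entry new(1) y(1) fW by (auto intro!: mult_right_mono less_imp_le)
    have "f a \<noteq> f b" using new(4) H by (auto simp: simple_graph_def)
    then have "A_alpha \<alpha> V E a b < A_alpha \<alpha> W H (f a) (f b)" using new \<alpha> by (auto simp: A_alpha_def)
    then show "\<exists>u\<in>V. A_alpha \<alpha> V E a u * y (f u) < A_alpha \<alpha> W H (f a) (f u) * y (f u)"
      using new(2) y(1) fW by (auto intro!: bexI[of _ b])
  qed (rule fin)
  obtain x where x: "\<exists>v\<in>V. x v \<noteq> 0"
    and xx: "(\<Sum>v\<in>V. x v * (\<Sum>u\<in>V. A_alpha \<alpha> V E v u * x u)) = rho_alpha \<alpha> V E * (\<Sum>v\<in>V. (x v)\<^sup>2)"
    and pos: "(\<Sum>v\<in>V. (x v)\<^sup>2) > 0"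
    by (rule rho_alpha_eigenvector[OF G ne])
  obtain z where z: "z \<in> V" "x z \<noteq> 0" using x by blast
  have "E \<le> (\<lambda>u v. u \<in> V \<and> v \<in> V \<and> 0 < A_alpha \<alpha> V E u v)"
    using EV \<alpha> G by (auto simp: A_alpha_def simple_graph_def)
  from predicate2D[OF rtranclp_mono[OF this]]
  have "(\<lambda>u v. u \<in> V \<and> v \<in> V \<and> 0 < A_alpha \<alpha> V E u v)\<^sup>*\<^sup>* u a" if "u \<in> V" for u
    using conn that new(1) unfolding connected_graph_def by blast
  moreover have "0 < y (f v)" if "v \<in> V" for v using y(1) fW that by simp
  moreover have "0 \<le> A_alpha \<alpha> V E u v" for u v using \<alpha> by (intro A_alpha_nonneg) auto
  ultimately have "(\<Sum>v\<in>V. x v * (\<Sum>u\<in>V. A_alpha \<alpha> V E v u * x u)) < l * (\<Sum>v\<in>V. (x v)\<^sup>2)"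
    using A_alpha_sym[OF G] le lt new(1) z
    by (intro quadratic_form_less[OF fin(1), of _ "\<lambda>v. y (f v)" l a z x]) blast+
  then show ?thesis using xx pos by simp
qed

lemma extremal_embedding:
  assumes G: "simple_graph V E" and S: "S = {h}" "S \<subseteq> V" and part: "partition_on (V - S) {C, D, D'}"
    and edge: "\<And>u v. E u v \<Longrightarrow> u \<in> S \<or> v \<in> S \<or> (\<exists>X\<in>{C, D, D'}. u \<in> X \<and> v \<in> X)"
    and n: "n \<ge> 18" and c: "card C = n - 5" "card D = 3" "card D' = 1" and ne: "C \<noteq> D" "C \<noteq> D'" "D \<noteq> D'"
  obtains f where "bij_betw f V (extremal_V n)" "\<And>u v. E u v \<Longrightarrow> extremal_E n (f u) (f v)"
proof -
  have U: "C \<union> D \<union> D' = V - S" and dj: "disjoint {C, D, D'}" using part by (auto simp: partition_on_def)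
  have disj: "C \<inter> D = {}" "C \<inter> D' = {}" "D \<inter> D' = {}" using dj ne by (auto simp: disjoint_def)
  have V: "V = {h} \<union> (C \<union> (D \<union> D'))" and h: "h \<notin> C \<union> (D \<union> D')" using U S by auto
  have "finite C" "finite D" "finite D'" using c n by (auto intro: card_ge_0_finite)
  then obtain p q r where p: "bij_betw p C {1..n-5}" and q: "bij_betw q D {n-4..n-2}" and r: "bij_betw r D' {n-1}"
    using finite_same_card_bij[of C "{1..n-5}"] finite_same_card_bij[of D "{n-4..n-2}"]
      finite_same_card_bij[of D' "{n-1}"] c n by auto
  define f where "f v = (if v \<in> C then p v else if v \<in> D then q v else if v \<in> D' then r v else 0)" for v
  have fC: "bij_betw f C {1..n-5}" using p by (rule bij_betw_cong[THEN iffD1, rotated]) (simp add: f_def)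
  have fD: "bij_betw f D {n-4..n-2}"
    using q by (rule bij_betw_cong[THEN iffD1, rotated]) (use disj in \<open>auto simp: f_def\<close>)
  have fD': "bij_betw f D' {n-1}"
    using r by (rule bij_betw_cong[THEN iffD1, rotated]) (use disj in \<open>auto simp: f_def\<close>)
  have fh: "f h = 0" using h by (simp add: f_def)
  have "bij_betw f ({h} \<union> (C \<union> (D \<union> D'))) ({0} \<union> ({1..n-5} \<union> ({n-4..n-2} \<union> {n-1})))"
    using fC fD fD' fh n by (intro bij_betw_combine) (auto simp: bij_betw_def)
  moreover have "{0} \<union> ({1..n-5} \<union> ({n-4..n-2} \<union> {n-1})) = extremal_V n"
    using n by (auto simp: extremal_V_def)
  ultimately have f: "bij_betw f V (extremal_V n)" using V by simp
  have "extremal_E n (f u) (f v)" if uv: "E u v" for u v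
  proof -
    have uvV: "u \<in> V" "v \<in> V" "u \<noteq> v" using uv G by (auto simp: simple_graph_def)
    then have "f u \<noteq> f v" "f u < n" "f v < n"
      using f by (auto simp: bij_betw_def inj_on_def extremal_V_def)
    moreover have "f u = 0 \<or> f v = 0 \<or> Defs.part n (f u) = Defs.part n (f v)"
    proof -
      consider "u = h" | "v = h" | "u \<in> C" "v \<in> C" | "u \<in> D" "v \<in> D" | "u \<in> D'" "v \<in> D'"
        using edge[OF uv] S by blast
      then show ?thesis
      proof cases
        case 3
        then have "f u \<in> {1..n-5}" "f v \<in> {1..n-5}" using fC by (auto simp: bij_betw_def)
        then show ?thesis by (auto simp: Defs.part_def)
      next
        case 4
        then have "f u \<in> {n-4..n-2}" "f v \<in> {n-4..n-2}" using fD by (auto simp: bij_betw_def)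
        then show ?thesis using n by (auto simp: Defs.part_def)
      next
        case 5
        then have "f u \<in> {n-1}" "f v \<in> {n-1}" using fD' by (auto simp: bij_betw_def)
        then show ?thesis by simp
      qed (use fh in auto)
    qed
    ultimately show ?thesis by (simp add: extremal_E_def)
  qed
  with f show ?thesis using that by blast
qed

theorem theorem1p1:
  fixes \<alpha> :: real and V :: "'a set" and E :: "'a \<Rightarrow> 'a \<Rightarrow> bool" and n :: nat
  assumes "0 \<le> \<alpha>" and "\<alpha> \<le> 1/2"
    and "simple_graph V E" and "connected_graph V E" and "one_binding V E"
    and "card V = n" and "even n"
    and "n \<ge> 18" and "\<alpha> < 1/2 \<Longrightarrow> real n \<ge> (2 + 8 * \<alpha>) / (1 - 2 * \<alpha>)"
    and "rho_alpha \<alpha> V E \<ge> rho_alpha \<alpha> (extremal_V n) (extremal_E n)"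
  shows "has_perfect_matching V E \<or> graph_iso V E (extremal_V n) (extremal_E n)"
proof (rule disjCI)
  note \<alpha> = assms(1,2) and G = assms(3) and n = assms(8)
  assume not_iso: "\<not> graph_iso V E (extremal_V n) (extremal_E n)"
  obtain l y where l: "l > real n - 5 + 4 * \<alpha> / (real n - 4)"
    and y: "\<And>v. v \<in> extremal_V n \<Longrightarrow> 0 < y v" "\<And>v. v \<in> extremal_V n \<Longrightarrow>
      (\<Sum>u\<in>extremal_V n. A_alpha \<alpha> (extremal_V n) (extremal_E n) v u * y u) = l * y v"
    using extremal_eigenvector[OF \<alpha> n] by blast
  have "0 \<in> extremal_V n" using n by (simp add: extremal_V_def)
  then have "\<exists>v\<in>extremal_V n. y v \<noteq> 0" using y(1) by force
  then have "l \<le> rho_alpha \<alpha> (extremal_V n) (extremal_E n)"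
    using y(2) by (intro rho_alpha_ge[OF simple_graph_extremal]) auto
  then have rho: "l \<le> rho_alpha \<alpha> V E" using assms(10) by simp
  show "has_perfect_matching V E"
  proof (rule ccontr)
    assume "\<not> has_perfect_matching V E"
    then have no: "\<nexists>m. pairing E V m" using has_perfect_matching_pairing by blast
    have "even (card V)" using assms(6,7) by simp
    from tutte[OF G this no] obtain S \<C> where S: "S \<subseteq> V" and part: "partition_on (V - S) \<C>"
      and edge: "\<And>u v. E u v \<Longrightarrow> u \<in> S \<or> v \<in> S \<or> (\<exists>C\<in>\<C>. u \<in> C \<and> v \<in> C)"
      and odd: "card S + 2 \<le> card {C\<in>\<C>. odd (card C)}"
      by blast
    define \<O> where "\<O> = {C\<in>\<C>. odd (card C)}"
    have fin: "finite V" using G by (simp add: simple_graph_def)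
    have UC: "\<Union>\<C> = V - S" and dC: "disjoint \<C>" and ne: "{} \<notin> \<C>" using part by (auto simp: partition_on_def)
    have finC: "finite \<C>" using part fin by (meson finite_Diff finite_elements)
    have finC': "finite C" if "C \<in> \<C>" for C
      using that UC fin by (metis Sup_upper finite_Diff finite_subset)
    have c1: "1 \<le> card C" if "C \<in> \<C>" for C
      using finC'[OF that] ne that by (metis Suc_leI card_gt_0_iff One_nat_def)
    have "card \<O> \<le> card \<C>" unfolding \<O>_def using finC by (intro card_mono) auto
    then have k: "card S + 2 \<le> card \<C>" using odd by (simp add: \<O>_def)
    have S0: "S \<noteq> {}" using connected_graph_separator_nonempty[OF G assms(4) part _ edge] k by simp
    have sing: "card {C\<in>\<C>. card C = 1} \<le> card S"
      by (rule one_binding_singletons_le[OF G assms(5) S part edge])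
    have total: "(\<Sum>C\<in>\<C>. card C) + card S = n"
      using card_Union_disjoint[of \<C>] UC dC finC' S fin assms(6)
      by (metis card_Diff_subset card_mono finite_subset le_add_diff_inverse2)
    have sing': "card {D\<in>\<O> - X. card D = 1} \<le> card S" for X
      using sing finC card_mono[of "{C\<in>\<C>. card C = 1}" "{D\<in>\<O> - X. card D = 1}"]
      by (fastforce simp: \<O>_def)
    have finO: "finite \<O>" using finC by (simp add: \<O>_def)
    have sub_le: "(\<Sum>D\<in>\<O> - X. card D) \<le> (\<Sum>D\<in>\<C> - X. card D)" for X
      using finC by (intro sum_mono2) (auto simp: \<O>_def)
    \<comment> \<open>All odd classes together are counted with \<open>j = 2\<close>; with one class
      \<open>C\<close> removed, \<open>j = 1\<close> remains and bounds the size of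
      \<open>C\<close>.\<close>
    have "card S + 3 * 2 \<le> (\<Sum>D\<in>\<O> - {}. card D)"
      using sing'[of "{}"] odd finO by (intro sum_odd_classes_ge) (auto simp: \<O>_def)
    then have n6: "2 * card S + 6 \<le> n" using sub_le[of "{}"] total by simp
    have M: "card C + 2 * card S + 3 \<le> n" if C: "C \<in> \<C>" for C
    proof -
      have "card S + 3 * 1 \<le> (\<Sum>D\<in>\<O> - {C}. card D)"
        using sing'[of "{C}"] odd finO by (intro sum_odd_classes_ge) (auto simp: \<O>_def card_Diff_singleton_if)
      then have "card S + 3 \<le> (\<Sum>D\<in>\<C> - {C}. card D)" using sub_le[of "{C}"] by simp
      then show ?thesis using total sum.remove[OF finC C, of card] by simp
    qed
    show False
    proof (cases "card S = 1 \<and> (\<exists>C\<in>\<C>. card C = n - 5)")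
      case False
      have "card C + 6 \<le> n" if "card S = 1" "C \<in> \<C>" for C
        using M[OF that(2)] that False by force
      then have "rho_alpha \<alpha> V E \<le> real n - 5 + 4 * \<alpha> / (real n - 4)"
        using M n6 by (intro rho_alpha_le_nonextremal[OF G \<alpha> S S0 part edge assms(6-8) k]) auto
      then show False using l rho by simp
    next
      case True
      then obtain C h where C: "C \<in> \<C>" "card C = n - 5" and h: "S = {h}" by (auto simp: card_1_singleton_iff)
      have rest: "(\<Sum>X\<in>\<C> - {C}. card X) = 4" using total sum.remove[OF finC C(1), of card] C(2) True n by simp
      have "2 \<le> card \<O> - card {C}" using odd True by (simp add: \<O>_def)
      then have O2: "2 \<le> card (\<O> - {C})" using diff_card_le_card_Diff[of "{C}" \<O>] by simp
      \<comment> \<open>At least two odd classes besides \<open>C\<close> share only 4 vertices, and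
        at most one of them is a singleton; this forces sizes 3 and 1 and leaves no room for another
        class.\<close>
      have "\<not> (\<O> - {C} \<subseteq> {D\<in>\<O> - {C}. card D = 1})"
      proof
        assume "\<O> - {C} \<subseteq> {D\<in>\<O> - {C}. card D = 1}"
        then have "card (\<O> - {C}) \<le> card {D\<in>\<O> - {C}. card D = 1}" using finO by (intro card_mono) auto
        then show False using sing'[of "{C}"] O2 True by simp
      qed
      then obtain D where D: "D \<in> \<O>" "D \<noteq> C" "card D \<noteq> 1" by blast
      have D3: "3 \<le> card D" using D by (intro odd_class_card_ge_3) (auto simp: \<O>_def)
      have "\<not> \<O> - {C} \<subseteq> {D}"
      proof
        assume "\<O> - {C} \<subseteq> {D}"
        then have "card (\<O> - {C}) \<le> card {D}" by (intro card_mono) auto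
        then show False using O2 by simp
      qed
      then obtain D' where D': "D' \<in> \<O>" "D' \<noteq> C" "D' \<noteq> D" by blast
      have inC: "D \<in> \<C>" "D' \<in> \<C>" using D D' by (auto simp: \<O>_def)
      have "(\<Sum>X\<in>\<C> - {C}. card X) = card D + (\<Sum>X\<in>\<C> - {C} - {D}. card X)"
        using finC inC D by (intro sum.remove) auto
      also have "(\<Sum>X\<in>\<C> - {C} - {D}. card X) = card D' + (\<Sum>X\<in>\<C> - {C} - {D} - {D'}. card X)"
        using finC inC D' by (intro sum.remove) auto
      finally have sums: "card D + (card D' + (\<Sum>X\<in>\<C> - {C} - {D} - {D'}. card X)) = 4" using rest by simp
      have cD: "card D = 3" "card D' = 1" and z: "(\<Sum>X\<in>\<C> - {C} - {D} - {D'}. card X) = 0"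
        using sums D3 c1[OF inC(2)] by linarith+
      have "\<C> - {C} - {D} - {D'} = {}"
      proof (rule ccontr)
        assume "\<C> - {C} - {D} - {D'} \<noteq> {}"
        then obtain X where "X \<in> \<C> - {C} - {D} - {D'}" by blast
        then have "card X = 0" using z finC by simp
        then show False using c1[of X] \<open>X \<in> \<C> - {C} - {D} - {D'}\<close> by simp
      qed
      then have eq: "\<C> = {C, D, D'}" using C inC by blast
      obtain f where f: "bij_betw f V (extremal_V n)" "\<And>u v. E u v \<Longrightarrow> extremal_E n (f u) (f v)"
        using extremal_embedding[OF G h S part[unfolded eq] edge[unfolded eq] n C(2) cD D(2)[symmetric] D'(2)[symmetric] D'(3)[symmetric]]
        by blast
      \<comment> \<open>\<open>f\<close> preserves edges but is no isomorphism, so some edge of the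
        extremal graph is missing in \<open>G\<close>.\<close>
      then obtain a b where "a \<in> V" "b \<in> V" "\<not> E a b" "extremal_E n (f a) (f b)"
        using not_iso unfolding graph_iso_def by blast
      then have "rho_alpha \<alpha> V E < l"
        using \<alpha> f y by (intro rho_alpha_less_supergraph[OF G assms(4) _ _ f(1) simple_graph_extremal]) auto
      then show False using rho by simp
    qed
  qed
qed

end
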